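(* There exist absolute constants $C,c_1,c_2>0$ such that the following holds. Let $d,N,L\in\mathbb{N}$ with $N\ge CdL^2$ and let $\Phi:\mathbb{R}^d\to\mathbb{R}$ be a random ReLU network of width $N$ with $L$ hidden layers, as described in the context, where all bias distributions are symmetric. Then: (1) $\mathrm{Lip}(\Phi)\ge\frac14\sqrt{d}$ with probability at least $\big(1-2^{-N}-\exp(-N/(CL^2))\big)^L\cdot(1-2\exp(-c_1d))_+$; (2) if additionally $N\ge CL^2\ln(4L)$ and $d>\ln(2)/c_1$, then $\mathbb{E}[\mathrm{Lip}(\Phi)]\ge c_2\sqrt{d}$.
   Context: A random ReLU network of width $N$ with $L$ hidden layers is $\Phi = V^{(L)}\circ\mathrm{ReLU}\circ V^{(L-1)}\circ\cdots\circ\mathrm{ReLU}\circ V^{(0)}$, where $\mathrm{ReLU}(t)=\max\{0,t\}$ acts componentwise and $V^{(\ell)}(x)=W^{(\ell)}x+b^{(\ell)}$ with $W^{(0)}\in\mathbb{R}^{N\times d}$, $W^{(\ell)}\in\mathbb{R}^{N\times N}$ for $1\le\ell\le L-1$, $W^{(L)}\in\mathbb{R}^{1\times N}$, $b^{(\ell)}\in\mathbb{R}^N$ for $\ell<L$, $b^{(L)}\in\mathbb{R}$. The entries of $W^{(\ell)}$, $0\le\ell<L$, are i.i.d. $\mathcal{N}(0,2/N)$; the entries of $W^{(L)}$ are i.i.d. $\mathcal{N}(0,1)$; $b^{(\ell)}_i\sim\mathcal{D}^{(\ell)}_i$ where each $\mathcal{D}^{(\ell)}_i$ is a symmetric probability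 distribution on $\mathbb{R}$ (e.g. the point mass at $0$); and all weights and biases are jointly independent. $\mathrm{Lip}(f)=\sup_{x\neq y}|f(x)-f(y)|/\|x-y\|_2$; $a_+=\max\{0,a\}$. *)

theory Defs
  imports "HOL-Probability.Probability"
begin

text \<open>Parameters of a ReLU network: weight entry (layer, row, column) or bias entry (layer, row).\<close>
datatype param = Wt nat nat nat | Bs nat nat

definition relu :: "real \<Rightarrow> real" where
  "relu t = max 0 t"

definition param_set :: "nat \<Rightarrow> nat \<Rightarrow> nat \<Rightarrow> param set" where
  "param_set d N L =
     {Wt 0 i j | i j. i < N \<and> j < d}
   \<union> {Wt l i j | l i j. 1 \<le> l \<and> l < L \<and> i < N \<and> j < N}
   \<union> {Wt L 0 j | j. j < N}
   \<union> {Bs l i | l i. l < L \<and> i < N}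
   \<union> {Bs L 0}"

definition gauss :: "real \<Rightarrow> real measure" where
  "gauss \<sigma> = density lborel (normal_density 0 \<sigma>)"

definition param_dist :: "nat \<Rightarrow> nat \<Rightarrow> (nat \<Rightarrow> nat \<Rightarrow> real measure) \<Rightarrow> param \<Rightarrow> real measure" where
  "param_dist N L D p = (case p of
      Wt l i j \<Rightarrow> (if l < L then gauss (sqrt (2 / real N)) else gauss 1)
    | Bs l i \<Rightarrow> D l i)"

definition net_measure :: "nat \<Rightarrow> nat \<Rightarrow> nat \<Rightarrow> (nat \<Rightarrow> nat \<Rightarrow> real measure) \<Rightarrow> (param \<Rightarrow> real) measure" where
  "net_measure d N L D = PiM (param_set d N L) (param_dist N L D)"

text \<open>Hidden activations after layer l+1 (i.e. ReLU(V^(l) ... ReLU(V^(0) x))); vectors are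
  functions nat => real, coordinates i >= N set to 0. Inputs use coordinates 0..d-1.\<close>
fun hidden :: "(param \<Rightarrow> real) \<Rightarrow> nat \<Rightarrow> nat \<Rightarrow> nat \<Rightarrow> (nat \<Rightarrow> real) \<Rightarrow> (nat \<Rightarrow> real)" where
  "hidden \<omega> d N 0 x = (\<lambda>i. if i < N then relu ((\<Sum>j<d. \<omega> (Wt 0 i j) * x j) + \<omega> (Bs 0 i)) else 0)"
| "hidden \<omega> d N (Suc l) x = (\<lambda>i. if i < N then
      relu ((\<Sum>j<N. \<omega> (Wt (Suc l) i j) * hidden \<omega> d N l x j) + \<omega> (Bs (Suc l) i)) else 0)"

text \<open>The network Phi = V^(L) o ReLU o ... o ReLU o V^(0) (for L >= 1).\<close>
definition net :: "(param \<Rightarrow> real) \<Rightarrow> nat \<Rightarrow> nat \<Rightarrow> nat \<Rightarrow> (nat \<Rightarrow> real) \<Rightarrow> real" where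
  "net \<omega> d N L x = (\<Sum>j<N. \<omega> (Wt L 0 j) * hidden \<omega> d N (L - 1) x j) + \<omega> (Bs L 0)"

definition Rd :: "nat \<Rightarrow> (nat \<Rightarrow> real) set" where
  "Rd d = {x. \<forall>i. d \<le> i \<longrightarrow> x i = 0}"

definition euclid_dist :: "nat \<Rightarrow> (nat \<Rightarrow> real) \<Rightarrow> (nat \<Rightarrow> real) \<Rightarrow> real" where
  "euclid_dist d x y = sqrt (\<Sum>i<d. (x i - y i)\<^sup>2)"

definition Lip :: "nat \<Rightarrow> ((nat \<Rightarrow> real) \<Rightarrow> real) \<Rightarrow> ennreal" where
  "Lip d f = (SUP p \<in> {(x, y). x \<in> Rd d \<and> y \<in> Rd d \<and> x \<noteq> y}.
                 ennreal (\<bar>f (fst p) - f (snd p)\<bar> / euclid_dist d (fst p) (snd p)))"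

definition symmetric_dist :: "real measure \<Rightarrow> bool" where
  "symmetric_dist D \<longleftrightarrow> prob_space D \<and> sets D = sets borel \<and> distr D borel uminus = D"

end

theory Submission
  imports Defs
begin

text \<open>The Lipschitz constant is bounded below by the norm of the gradient \<open>g\<close> at one fixed
  nonzero point \<open>x\<close>, at which the network is almost surely differentiable. Conditionally on the
  hidden layers, \<open>g = M\<^sup>T w\<close> with \<open>w\<close> standard Gaussian and \<open>M\<close> the Jacobian of the last hidden
  layer, and
  \<open>E exp (- \<bar>M\<^sup>T w\<bar>\<^sup>2) = E exp (- \<bar>M z\<bar>\<^sup>2)\<close> for a standard Gaussian \<open>z\<close> in the input space.
  By the sign symmetry of each row of weights and bias, a neuron is active with probability 1/2
  independently of the square of its derivative, so one layer maps a tangent vector \<open>u\<close> to \<open>u'\<close> with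
  \<open>E exp (- s \<bar>u'\<bar>\<^sup>2) \<le> exp (- \<theta> s \<bar>u\<bar>\<^sup>2) + exp (- \<theta> Y)\<close>, where \<open>\<theta> = 1 - 3 Y / N\<close> and the cut-off \<open>Y\<close>
  is free. With \<open>Y = 4 d L\<close> and \<open>N \<ge> 24 d L\<^sup>2\<close> the total loss \<open>\<theta> ^ L\<close> is at least 1/2, so
  \<open>E exp (- \<bar>g\<bar>\<^sup>2)\<close> is at most about \<open>2 powr (- d / 2)\<close>. Markov's inequality then gives
  \<open>\<bar>g\<bar>\<^sup>2 > d / 16\<close> with probability at least \<open>1 - 2 exp (- d / 4)\<close>, which is stronger than the
  claim because the factor raised to the power \<open>L\<close> has absolute value at most 1.\<close>

subsection \<open>Gaussian vectors\<close>

lemma sets_gauss [simp, measurable_cong]: "sets (gauss \<sigma>) = sets borel"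
  by (simp add: gauss_def)

lemma space_gauss [simp]: "space (gauss \<sigma>) = UNIV"
  by (simp add: gauss_def)

lemma prob_space_gauss: "\<sigma> > 0 \<Longrightarrow> prob_space (gauss \<sigma>)"
  unfolding gauss_def by (rule prob_space_normal_density)

lemma gauss_1: "gauss 1 = std_normal_distribution"
  by (simp add: gauss_def)

lemma distr_gauss_scale:
  assumes "\<sigma> > 0" "a \<noteq> 0"
  shows "distr (gauss \<sigma>) borel (\<lambda>x. a * x) = gauss (\<bar>a\<bar> * \<sigma>)"
proof -
  interpret prob_space "gauss \<sigma>" using assms(1) by (rule prob_space_gauss)
  have "distributed (gauss \<sigma>) lborel (\<lambda>x. x) (normal_density 0 \<sigma>)"
    unfolding distributed_def gauss_def by (auto simp: distr_id2 )
  from normal_density_affine[OF this assms, of 0]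
  have "distributed (gauss \<sigma>) lborel (\<lambda>x. a * x) (normal_density 0 (\<bar>a\<bar> * \<sigma>))" by simp
  then have "distr (gauss \<sigma>) lborel (\<lambda>x. a * x) = gauss (\<bar>a\<bar> * \<sigma>)"
    unfolding distributed_def by (simp add: gauss_def)
  moreover have "distr (gauss \<sigma>) lborel (\<lambda>x. a * x) = distr (gauss \<sigma>) borel (\<lambda>x. a * x)"
    by (rule distr_cong) auto
  ultimately show ?thesis by simp
qed

lemma symmetric_dist_gauss: "\<sigma> > 0 \<Longrightarrow> symmetric_dist (gauss \<sigma>)"
  using distr_gauss_scale[of \<sigma> "-1"] by (simp add: symmetric_dist_def prob_space_gauss)

lemma char_gauss:
  assumes "\<sigma> > 0"
  shows "char (gauss \<sigma>) t = complex_of_real (exp (- ((\<sigma> * t)\<^sup>2) / 2))"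
proof -
  have "char (gauss \<sigma>) t = char (distr (gauss 1) borel (\<lambda>x. \<sigma> * x)) t"
    using distr_gauss_scale[of 1 \<sigma>] assms by simp
  also have "\<dots> = char (gauss 1) (\<sigma> * t)"
    unfolding char_def by (subst integral_distr) (auto simp: mult_ac)
  finally show ?thesis by (simp add: gauss_1 char_std_normal_distribution)
qed

lemma AE_gauss_neq: "\<sigma> > 0 \<Longrightarrow> AE x in gauss \<sigma>. x \<noteq> c"
  unfolding gauss_def using AE_lborel_singleton[of c] by (subst AE_density) auto

lemma nn_integral_std_gauss_exp_square:
  assumes "a \<ge> 0"
  shows "(\<integral>\<^sup>+x. ennreal (exp (- (a * x\<^sup>2))) \<partial>gauss 1) = ennreal (1 / sqrt (1 + 2 * a))"
proof -
  \<comment> \<open>Multiplying the standard density by \<open>exp (- (a * x\<^sup>2))\<close> gives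
    a multiple of a centred Gaussian density of variance \<open>1 / (1 + 2 * a)\<close>; its
    standard deviation \<open>\<tau>\<close> is also the missing normalisation.\<close>
  define \<tau> where "\<tau> = 1 / sqrt (1 + 2 * a)"
  have \<tau>: "\<tau> > 0" "\<tau>\<^sup>2 = 1 / (1 + 2 * a)"
    using assms by (auto simp: \<tau>_def power_divide)
  have eq: "std_normal_density x * exp (- (a * x\<^sup>2)) = \<tau> * normal_density 0 \<tau> x" for x
  proof -
    have "exp (- x\<^sup>2 / 2) * exp (- (a * x\<^sup>2)) = exp (- x\<^sup>2 / (2 * \<tau>\<^sup>2))"
      unfolding exp_add[symmetric] \<tau>(2) by (simp add: field_simps)
    moreover have "sqrt (2 * pi * \<tau>\<^sup>2) = sqrt (2 * pi) * \<tau>"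
      using \<tau>(1) by (simp add: real_sqrt_mult)
    ultimately show ?thesis
      using \<tau>(1) by (simp add: normal_density_def)
  qed
  have "(\<integral>\<^sup>+x. ennreal (exp (- (a * x\<^sup>2))) \<partial>gauss 1)
      = (\<integral>\<^sup>+x. ennreal (std_normal_density x * exp (- (a * x\<^sup>2))) \<partial>lborel)"
    unfolding gauss_def by (subst nn_integral_density) (auto simp: ennreal_mult)
  also have "\<dots> = (\<integral>\<^sup>+x. ennreal \<tau> * ennreal (normal_density 0 \<tau> x) \<partial>lborel)"
    using \<tau>(1) by (simp add: eq ennreal_mult)
  also have "\<dots> = ennreal \<tau> * emeasure (gauss \<tau>) (space (gauss \<tau>))"
    by (subst nn_integral_cmult) (auto simp: gauss_def emeasure_density)
  also have "\<dots> = ennreal \<tau>"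
    using prob_space.emeasure_space_1[OF prob_space_gauss[OF \<tau>(1)]] by simp
  finally show ?thesis by (simp add: \<tau>_def)
qed

lemma prob_space_PiM_gauss: "\<sigma> > 0 \<Longrightarrow> prob_space (PiM I (\<lambda>_. gauss \<sigma>))"
  by (intro prob_space_PiM prob_space_gauss)

lemma integral_PiM_gauss_iexp:
  assumes "\<sigma> > 0" "finite I"
  shows "(CLINT w|PiM I (\<lambda>_. gauss \<sigma>). iexp (\<Sum>i\<in>I. w i * a i))
       = complex_of_real (exp (- (\<sigma>\<^sup>2 * (\<Sum>i\<in>I. (a i)\<^sup>2)) / 2))"
proof -
  interpret product_prob_space "\<lambda>_. gauss \<sigma>" I
    using assms by (intro product_prob_spaceI prob_space_gauss)
  have "(CLINT w|PiM I (\<lambda>_. gauss \<sigma>). iexp (\<Sum>i\<in>I. w i * a i))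
      = (CLINT w|PiM I (\<lambda>_. gauss \<sigma>). (\<Prod>i\<in>I. iexp (a i * w i)))"
    using assms by (simp add: exp_sum sum_distrib_left mult_ac)
  also have "\<dots> = (\<Prod>i\<in>I. char (gauss \<sigma>) (a i))"
    unfolding char_def using assms
    by (intro product_integral_prod prob_space.integrable_iexp) (auto intro: prob_space_gauss)
  also have "\<dots> = complex_of_real (exp (- (\<sigma>\<^sup>2 * (\<Sum>i\<in>I. (a i)\<^sup>2)) / 2))"
    using assms
    by (simp add: char_gauss flip: of_real_prod exp_sum)
       (simp add: sum_distrib_left sum_divide_distrib sum_negf power_mult_distrib)
  finally show ?thesis .
qed

text \<open>Both sides are the expectation of \<open>exp (\<i> * sqrt (2 * t) * w\<^sup>T M z)\<close> over independent
  Gaussian vectors \<open>w\<close> and \<open>z\<close>, computed in the two possible orders.\<close>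
lemma gauss_duality:
  fixes M :: "'i \<Rightarrow> 'j \<Rightarrow> real"
  assumes \<sigma>: "\<sigma> > 0" and fin: "finite I" "finite J" and t: "t \<ge> 0"
  shows "(\<integral>\<^sup>+w. ennreal (exp (- (t * (\<Sum>j\<in>J. (\<Sum>i\<in>I. w i * M i j)\<^sup>2)))) \<partial>PiM I (\<lambda>_. gauss \<sigma>))
       = (\<integral>\<^sup>+z. ennreal (exp (- (t * \<sigma>\<^sup>2 * (\<Sum>i\<in>I. (\<Sum>j\<in>J. M i j * z j)\<^sup>2)))) \<partial>PiM J (\<lambda>_. gauss 1))"
proof -
  let ?I = "PiM I (\<lambda>_. gauss \<sigma>)" and ?J = "PiM J (\<lambda>_. gauss 1)"
  interpret I: prob_space ?I using \<sigma> by (rule prob_space_PiM_gauss)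
  interpret J: prob_space ?J by (rule prob_space_PiM_gauss) simp
  interpret IJ: pair_prob_space ?I ?J ..
  \<comment> \<open>The frequency \<open>sqrt (2 * t)\<close> cancels the factor 1/2 in the Gaussian
    characteristic function. As \<open>F\<close> has modulus 1, Fubini applies.\<close>
  define F where "F = (\<lambda>w z. iexp (sqrt (2 * t) * (\<Sum>i\<in>I. \<Sum>j\<in>J. w i * M i j * z j)))"
  have [measurable]: "case_prod F \<in> borel_measurable (?I \<Otimes>\<^sub>M ?J)"
    unfolding F_def split_def by measurable
  have "integrable (?I \<Otimes>\<^sub>M ?J) (case_prod F)"
    by (rule IJ.P.integrable_const_bound[of _ 1]) (auto simp: F_def)
  from IJ.Fubini_integral[OF this]
  have Fub: "(CLINT z|?J. CLINT w|?I. F w z) = (CLINT w|?I. CLINT z|?J. F w z)" .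
  have "(CLINT w|?I. F w z) = complex_of_real (exp (- (t * \<sigma>\<^sup>2 * (\<Sum>i\<in>I. (\<Sum>j\<in>J. M i j * z j)\<^sup>2))))" for z
  proof -
    have "F w z = iexp (\<Sum>i\<in>I. w i * (sqrt (2 * t) * (\<Sum>j\<in>J. M i j * z j)))" for w
      unfolding F_def by (simp add: sum_distrib_left mult_ac)
    then show ?thesis
      using integral_PiM_gauss_iexp[OF \<sigma> fin(1), of "\<lambda>i. sqrt (2 * t) * (\<Sum>j\<in>J. M i j * z j)"] t
      by (simp add: power_mult_distrib sum_distrib_left[symmetric])
  qed
  moreover have "(CLINT z|?J. F w z) = complex_of_real (exp (- (t * (\<Sum>j\<in>J. (\<Sum>i\<in>I. w i * M i j)\<^sup>2))))" for w
  proof -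
    have "F w z = iexp (\<Sum>j\<in>J. z j * (sqrt (2 * t) * (\<Sum>i\<in>I. w i * M i j)))" for z
      unfolding F_def by (subst sum.swap) (simp add: sum_distrib_left sum_distrib_right mult_ac)
    then show ?thesis
      using integral_PiM_gauss_iexp[OF _ fin(2), of 1 "\<lambda>j. sqrt (2 * t) * (\<Sum>i\<in>I. w i * M i j)"] t
      by (simp add: power_mult_distrib sum_distrib_left[symmetric])
  qed
  ultimately have "(LINT w|?I. exp (- (t * (\<Sum>j\<in>J. (\<Sum>i\<in>I. w i * M i j)\<^sup>2))))
      = (LINT z|?J. exp (- (t * \<sigma>\<^sup>2 * (\<Sum>i\<in>I. (\<Sum>j\<in>J. M i j * z j)\<^sup>2))))"
    using Fub by (simp del: of_real_exp)
  moreover have "integrable ?I (\<lambda>w. exp (- (t * (\<Sum>j\<in>J. (\<Sum>i\<in>I. w i * M i j)\<^sup>2))))"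
    using t by (intro I.integrable_const_bound[of _ 1]) (auto intro!: mult_nonneg_nonneg sum_nonneg)
  moreover have "integrable ?J (\<lambda>z. exp (- (t * \<sigma>\<^sup>2 * (\<Sum>i\<in>I. (\<Sum>j\<in>J. M i j * z j)\<^sup>2))))"
    using t by (intro J.integrable_const_bound[of _ 1]) (auto intro!: mult_nonneg_nonneg sum_nonneg)
  ultimately show ?thesis
    by (simp add: nn_integral_eq_integral)
qed

lemma nn_integral_PiM_gauss_exp_square:
  assumes "finite J" "a \<ge> 0"
  shows "(\<integral>\<^sup>+z. ennreal (exp (- (a * (\<Sum>j\<in>J. (z j)\<^sup>2)))) \<partial>PiM J (\<lambda>_. gauss 1))
       = ennreal ((1 / sqrt (1 + 2 * a)) ^ card J)"
proof -
  interpret product_prob_space "\<lambda>_. gauss 1" J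
    by (intro product_prob_spaceI prob_space_gauss) simp
  have "(\<integral>\<^sup>+z. ennreal (exp (- (a * (\<Sum>j\<in>J. (z j)\<^sup>2)))) \<partial>PiM J (\<lambda>_. gauss 1))
      = (\<integral>\<^sup>+z. (\<Prod>j\<in>J. ennreal (exp (- (a * (z j)\<^sup>2)))) \<partial>PiM J (\<lambda>_. gauss 1))"
    using assms by (simp add: prod_ennreal sum_distrib_left flip: exp_sum sum_negf)
  also have "\<dots> = (\<Prod>j\<in>J. \<integral>\<^sup>+x. ennreal (exp (- (a * x\<^sup>2))) \<partial>gauss 1)"
    using assms by (intro product_nn_integral_prod) auto
  finally show ?thesis
    using assms by (simp add: nn_integral_std_gauss_exp_square prod_ennreal ennreal_power)
qed

text \<open>Duality with a single column, indexed by \<open>()\<close>, trades the linear form for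
  one scalar Gaussian scaled by the norm of \<open>u\<close>.\<close>

lemma nn_integral_PiM_gauss_linear:
  assumes "\<sigma> > 0" "finite I" "t \<ge> 0"
  shows "(\<integral>\<^sup>+w. ennreal (exp (- (t * (\<Sum>i\<in>I. w i * u i)\<^sup>2))) \<partial>PiM I (\<lambda>_. gauss \<sigma>))
       = ennreal (1 / sqrt (1 + 2 * (t * \<sigma>\<^sup>2 * (\<Sum>i\<in>I. (u i)\<^sup>2))))"
proof -
  have "(\<integral>\<^sup>+w. ennreal (exp (- (t * (\<Sum>i\<in>I. w i * u i)\<^sup>2))) \<partial>PiM I (\<lambda>_. gauss \<sigma>))
      = (\<integral>\<^sup>+z. ennreal (exp (- (t * \<sigma>\<^sup>2 * (\<Sum>i\<in>I. (u i)\<^sup>2) * (\<Sum>j\<in>{()}. (z j)\<^sup>2)))) \<partial>PiM {()} (\<lambda>_. gauss 1))"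
    using gauss_duality[OF assms(1,2) finite.insertI[OF finite.emptyI] assms(3), of "\<lambda>i _. u i" "()"]
    by (simp add: power_mult_distrib sum_distrib_left sum_distrib_right mult_ac)
  also have "\<dots> = ennreal (1 / sqrt (1 + 2 * (t * \<sigma>\<^sup>2 * (\<Sum>i\<in>I. (u i)\<^sup>2))))"
    using assms by (subst nn_integral_PiM_gauss_exp_square) (auto intro!: mult_nonneg_nonneg sum_nonneg)
  finally show ?thesis .
qed

subsection \<open>Product measures\<close>

text \<open>For \<open>p \<notin> I\<close> the coordinate is the constant \<open>undefined\<close> on the space.\<close>
lemma measurable_PiM_real_component:
  fixes P :: "'i \<Rightarrow> real measure"
  assumes "\<And>p. p \<in> I \<Longrightarrow> sets (P p) = sets borel"
  shows "(\<lambda>\<omega>. \<omega> p) \<in> borel_measurable (PiM I P)"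
proof (cases "p \<in> I")
  case True
  then show ?thesis
    using measurable_component_singleton[of p I P] measurable_cong_sets[OF refl assms] by blast
next
  case False
  then have "(\<lambda>\<omega>. \<omega> p) \<in> borel_measurable (PiM I P) \<longleftrightarrow> (\<lambda>\<omega>. undefined :: real) \<in> borel_measurable (PiM I P)"
    by (intro measurable_cong) (auto simp: space_PiM PiE_def extensional_def)
  then show ?thesis by simp
qed

lemma nn_integral_PiM_restrict:
  assumes "\<And>i. prob_space (P i)" "finite I" "J \<subseteq> I" "f \<in> borel_measurable (PiM J P)"
  shows "(\<integral>\<^sup>+\<omega>. f (restrict \<omega> J) \<partial>PiM I P) = (\<integral>\<^sup>+\<omega>. f \<omega> \<partial>PiM J P)"
proof -
  interpret product_prob_space P I
    using assms(1) by (rule product_prob_spaceI)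
  have "(\<integral>\<^sup>+\<omega>. f \<omega> \<partial>PiM J P) = (\<integral>\<^sup>+\<omega>. f \<omega> \<partial>distr (PiM I P) (PiM J P) (\<lambda>\<omega>. restrict \<omega> J))"
    using assms by (subst distr_PiM_restrict_finite) (auto intro: finite_subset)
  also have "\<dots> = (\<integral>\<^sup>+\<omega>. f (restrict \<omega> J) \<partial>PiM I P)"
    using assms by (intro nn_integral_distr) (auto intro!: measurable_restrict_subset)
  finally show ?thesis by simp
qed

text \<open>Independence of disjoint blocks of coordinates: \<open>restrict\<close> makes each
  factor depend on its own block only, and Fubini splits off one block at a time.\<close>

lemma nn_integral_PiM_blocks:
  assumes P: "\<And>i. prob_space (P i)" and "finite A" "disjoint_family_on R A"
    and "\<And>a. a \<in> A \<Longrightarrow> finite (R a)"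
    and "\<And>a. a \<in> A \<Longrightarrow> f a \<in> borel_measurable (PiM (R a) P)"
  shows "(\<integral>\<^sup>+\<omega>. (\<Prod>a\<in>A. f a (restrict \<omega> (R a))) \<partial>PiM (\<Union>a\<in>A. R a) P)
       = (\<Prod>a\<in>A. \<integral>\<^sup>+\<omega>. f a \<omega> \<partial>PiM (R a) P)"
  using assms(2-)
proof (induction A rule: finite_induct)
  case empty
  interpret prob_space "PiM {} P" using P by (rule prob_space_PiM)
  show ?case by (simp add: emeasure_space_1)
next
  case (insert a A)
  interpret product_prob_space P "\<Union>a\<in>insert a A. R a"
    using P by (rule product_prob_spaceI)
  let ?U = "\<Union>b\<in>A. R b"
  have disj: "R a \<inter> ?U = {}"
    using insert.prems(1) insert.hyps(2) unfolding disjoint_family_on_def by auto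
  have fin: "finite (R a)" "finite ?U" using insert by auto
  have meas_res: "(\<lambda>\<omega>. f b (restrict \<omega> (R b))) \<in> borel_measurable (PiM K P)"
    if "b \<in> insert a A" "R b \<subseteq> K" for b K
    using measurable_compose[OF measurable_restrict_subset[OF that(2)] insert.prems(3)[OF that(1)]] .
  have "(\<integral>\<^sup>+\<omega>. (\<Prod>b\<in>insert a A. f b (restrict \<omega> (R b))) \<partial>PiM (\<Union>b\<in>insert a A. R b) P)
      = (\<integral>\<^sup>+x. (\<integral>\<^sup>+y. (\<Prod>b\<in>insert a A. f b (restrict (merge (R a) ?U (x, y)) (R b)))
            \<partial>PiM ?U P) \<partial>PiM (R a) P)"
  proof -
    have "(\<lambda>\<omega>. \<Prod>b\<in>insert a A. f b (restrict \<omega> (R b))) \<in> borel_measurable (PiM (R a \<union> ?U) P)"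
      by (intro borel_measurable_prod_ennreal meas_res) auto
    from product_nn_integral_fold[OF disj fin this] show ?thesis by simp
  qed
  also have "\<dots> = (\<integral>\<^sup>+x. (\<integral>\<^sup>+y. f a x * (\<Prod>b\<in>A. f b (restrict y (R b))) \<partial>PiM ?U P) \<partial>PiM (R a) P)"
  proof (intro nn_integral_cong)
    fix x y assume x: "x \<in> space (PiM (R a) P)"
    have "restrict (merge (R a) ?U (x, y)) (R a) = x"
      using x by (auto simp: merge_def fun_eq_iff restrict_def space_PiM PiE_def extensional_def)
    moreover have "restrict (merge (R a) ?U (x, y)) (R b) = restrict y (R b)" if "b \<in> A" for b
      using that disj by (auto simp: merge_def fun_eq_iff restrict_def)
    ultimately show "(\<Prod>b\<in>insert a A. f b (restrict (merge (R a) ?U (x, y)) (R b)))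
        = f a x * (\<Prod>b\<in>A. f b (restrict y (R b)))"
      using insert.hyps by simp
  qed
  also have "\<dots> = (\<integral>\<^sup>+x. f a x \<partial>PiM (R a) P) * (\<integral>\<^sup>+y. (\<Prod>b\<in>A. f b (restrict y (R b))) \<partial>PiM ?U P)"
  proof -
    have "(\<lambda>y. \<Prod>b\<in>A. f b (restrict y (R b))) \<in> borel_measurable (PiM ?U P)"
      by (intro borel_measurable_prod_ennreal meas_res) auto
    with insert.prems(3) show ?thesis
      by (subst nn_integral_cmult) (auto intro!: nn_integral_multc)
  qed
  also have "(\<integral>\<^sup>+y. (\<Prod>b\<in>A. f b (restrict y (R b))) \<partial>PiM ?U P) = (\<Prod>b\<in>A. \<integral>\<^sup>+\<omega>. f b \<omega> \<partial>PiM (R b) P)"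
    using insert.prems by (intro insert.IH) (auto simp: disjoint_family_on_def)
  finally show ?case using insert.hyps by simp
qed

text \<open>With all other coordinates fixed, the expression vanishes only at
  \<open>- c \<omega> / h \<omega>\<close>, a single value of coordinate \<open>p\<close>, which is
  null because \<open>P p\<close> has no atoms. The \<open>upd\<close> assumptions say that slope
  and offset do not involve that coordinate.\<close>

lemma AE_PiM_affine_neq_0:
  assumes P: "\<And>i. prob_space (P i)" and I: "finite I" "p \<in> I"
    and Pp: "sets (P p) = sets borel" "\<And>c::real. AE x in P p. x \<noteq> c"
    and [measurable]: "h \<in> borel_measurable (PiM I P)" "c \<in> borel_measurable (PiM I P)"
    and upd: "\<And>\<omega> v. h (fun_upd \<omega> p v) = h \<omega>" "\<And>\<omega> v. c (fun_upd \<omega> p v) = c \<omega>"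
  shows "AE \<omega> in PiM I P. h \<omega> \<noteq> 0 \<longrightarrow> \<omega> p * h \<omega> + c \<omega> \<noteq> 0"
proof -
  interpret product_prob_space P I
    using P by (rule product_prob_spaceI)
  have [measurable]: "(\<lambda>\<omega>. \<omega> p) \<in> borel_measurable (PiM I P)"
    using measurable_component_singleton[OF I(2), of P] measurable_cong_sets[OF refl Pp(1)] by blast
  define B where "B = {\<omega> \<in> space (PiM I P). h \<omega> \<noteq> 0 \<and> \<omega> p * h \<omega> + c \<omega> = 0}"
  have B [measurable]: "B \<in> sets (PiM I P)" unfolding B_def by measurable
  have ins: "insert p (I - {p}) = I" using I by auto
  have "emeasure (PiM I P) B = (\<integral>\<^sup>+\<omega>. indicator B \<omega> \<partial>PiM (insert p (I - {p})) P)"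
    unfolding ins using B by simp
  also have "\<dots> = (\<integral>\<^sup>+\<omega>. (\<integral>\<^sup>+v. indicator B (fun_upd \<omega> p v) \<partial>P p) \<partial>PiM (I - {p}) P)"
  proof -
    have "(indicator B :: _ \<Rightarrow> ennreal) \<in> borel_measurable (PiM (insert p (I - {p})) P)"
      unfolding ins using B by simp
    with I show ?thesis by (intro product_nn_integral_insert) auto
  qed
  also have "\<dots> = (\<integral>\<^sup>+\<omega>. 0 \<partial>PiM (I - {p}) P)"
  proof (intro nn_integral_cong)
    fix \<omega>
    have "AE v in P p. indicator B (fun_upd \<omega> p v) = (0::ennreal)"
      using Pp(2)[of "- c \<omega> / h \<omega>"]
      by eventually_elim (auto simp: B_def upd field_simps indicator_def eq_neg_iff_add_eq_0)
    then have "(\<integral>\<^sup>+v. indicator B (fun_upd \<omega> p v) \<partial>P p) = (\<integral>\<^sup>+v. 0 \<partial>P p)"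
      by (rule nn_integral_cong_AE)
    then show "(\<integral>\<^sup>+v. indicator B (fun_upd \<omega> p v) \<partial>P p) = 0" by simp
  qed
  finally have "emeasure (PiM I P) B = 0" by simp
  then show ?thesis
    using B by (intro AE_I[of _ _ B]) (auto simp: B_def)
qed

lemma nn_integral_PiM_uminus:
  assumes "\<And>i. i \<in> I \<Longrightarrow> symmetric_dist (P i)" "finite I" "f \<in> borel_measurable (PiM I P)"
  shows "(\<integral>\<^sup>+\<omega>. f (\<lambda>i\<in>I. - \<omega> i) \<partial>PiM I P) = (\<integral>\<^sup>+\<omega>. f \<omega> \<partial>PiM I P)"
proof -
  have P: "prob_space (P i)" "sets (P i) = sets borel" "distr (P i) borel uminus = P i" if "i \<in> I" for i
    using assms(1)[OF that] by (auto simp: symmetric_dist_def)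
  have um: "uminus \<in> measurable (P i) (P i)" if "i \<in> I" for i
    using P(2)[OF that] measurable_cong_sets[of "P i" borel "P i" borel] by simp
  have "distr (P i) (P i) uminus = P i" if "i \<in> I" for i
    using P[OF that] distr_cong[of "P i" "P i" "P i" borel uminus uminus] by simp
  then have "distr (PiM I P) (PiM I P) (compose I uminus) = PiM I P"
    using assms(2) P(1) um
    by (subst distr_PiM_finite_prob_space') (auto intro!: PiM_cong)
  then have "(\<integral>\<^sup>+\<omega>. f \<omega> \<partial>PiM I P) = (\<integral>\<^sup>+\<omega>. f \<omega> \<partial>distr (PiM I P) (PiM I P) (compose I uminus))"
    by simp
  also have "\<dots> = (\<integral>\<^sup>+\<omega>. f (compose I uminus \<omega>) \<partial>PiM I P)"
  proof (rule nn_integral_distr)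
    show "compose I uminus \<in> measurable (PiM I P) (PiM I P)"
      unfolding compose_def using um
      by (intro measurable_restrict) (auto intro: measurable_compose[OF measurable_component_singleton])
  qed (use assms in auto)
  finally show ?thesis by (simp add: compose_def)
qed

subsection \<open>Elementary estimates\<close>

text \<open>The bound is the second-order Taylor polynomial \<open>p\<close> at 0. After squaring it
  reads \<open>(1 + x) * p\<^sup>2 \<ge> 1\<close>, and the excess over 1 is \<open>x ^ 3\<close>
  times a positive quadratic.\<close>

lemma inverse_sqrt_le_quadratic:
  fixes x :: real
  assumes "x \<ge> 0"
  shows "1 / sqrt (1 + x) \<le> 1 - x / 2 + 3 * x\<^sup>2 / 8"
proof -
  define p where "p = 1 - x / 2 + 3 * x\<^sup>2 / 8"
  have p: "p = 3 / 8 * (x - 2 / 3)\<^sup>2 + 5 / 6"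
    by (simp add: p_def power2_eq_square field_simps)
  have p0: "p > 0" unfolding p by (intro add_nonneg_pos) auto
  have "(1 + x) * p\<^sup>2 = 1 + x ^ 3 * (9 / 64 * (x - 5 / 6)\<^sup>2 + 135 / 256)"
    by (simp add: p_def power2_eq_square power3_eq_cube field_simps)
  also have "\<dots> \<ge> 1" using assms by simp
  finally have "1 \<le> sqrt ((1 + x) * p\<^sup>2)" by simp
  also have "\<dots> = sqrt (1 + x) * p" using p0 by (simp add: real_sqrt_mult)
  finally show ?thesis
    unfolding p_def[symmetric] using assms by (simp add: field_simps)
qed

text \<open>To first order the left side is \<open>exp (- y)\<close>. The second-order correction
  \<open>3 * y\<^sup>2 / N\<close> is absorbed into \<open>\<theta>\<close> as long as
  \<open>y \<le> Y\<close>; beyond the cut-off, monotonicity bounds the left side by its value at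
  \<open>Y\<close>.\<close>

lemma layer_laplace_bound:
  fixes y Y :: real
  assumes "y \<ge> 0" "Y \<ge> 0" "N \<ge> (1::nat)"
  defines "\<theta> \<equiv> 1 - 3 * Y / N"
  shows "((1 + 1 / sqrt (1 + 4 * y / N)) / 2) ^ N \<le> exp (- (\<theta> * y)) + exp (- (\<theta> * Y))"
proof -
  define h where "h = (\<lambda>y::real. ((1 + 1 / sqrt (1 + 4 * y / N)) / 2) ^ N)"
  have N: "real N > 0" using assms by simp
  have h_le: "h v \<le> exp (- ((1 - 3 * v / N) * v))" if "v \<ge> 0" for v
  proof -
    have "(1 + 1 / sqrt (1 + 4 * v / N)) / 2 \<le> 1 + (- v / N + 3 * (v / N)\<^sup>2)"
      using inverse_sqrt_le_quadratic[of "4 * v / N"] that N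
      by (simp add: power_divide power_mult_distrib field_simps)
    also have "\<dots> \<le> exp (- v / N + 3 * (v / N)\<^sup>2)" by (rule exp_ge_add_one_self)
    finally have "h v \<le> exp (- v / N + 3 * (v / N)\<^sup>2) ^ N"
      unfolding h_def using that by (intro power_mono) auto
    also have "\<dots> = exp (- ((1 - 3 * v / N) * v))"
      using N by (simp add: power2_eq_square field_simps flip: exp_of_nat_mult)
    finally show ?thesis .
  qed
  have "h y \<le> exp (- (\<theta> * y)) + exp (- (\<theta> * Y))"
  proof (cases "y \<le> Y")
    case True
    have "\<theta> * y \<le> (1 - 3 * y / N) * y"
      unfolding \<theta>_def using True assms(1) N by (intro mult_right_mono) (auto simp: divide_right_mono)
    then have "h y \<le> exp (- (\<theta> * y))"
      using h_le[OF assms(1)] by (smt (verit) exp_le_cancel_iff)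
    then show ?thesis by (smt (verit) exp_gt_zero)
  next
    case False
    have "h y \<le> h Y"
      unfolding h_def using False assms(1,2) N
      by (intro power_mono divide_right_mono add_left_mono frac_le real_sqrt_le_mono mult_left_mono)
         (auto intro!: add_pos_nonneg)
    also have "\<dots> \<le> exp (- (\<theta> * Y))"
      using h_le[OF assms(2)] by (simp add: \<theta>_def)
    finally show ?thesis by (smt (verit) exp_gt_zero)
  qed
  then show ?thesis by (simp add: h_def)
qed

text \<open>\<open>exp (real d / 16)\<close> is the price of Markov's inequality at level
  \<open>d / 16\<close>. The first summand has exponent at most \<open>- 5 * d / 16\<close>, because
  \<open>ln 2 \<ge> 5 / 8\<close>, which leaves exactly \<open>- d / 4\<close>. In the second,
  \<open>L \<le> exp L\<close> and \<open>L - 2 * d * L \<le> - d\<close>.\<close>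

lemma chernoff_exponents:
  fixes \<theta> :: real and d L :: nat
  assumes "1 / 2 \<le> \<theta>" "1 / 2 \<le> \<theta> ^ L" "L \<ge> 1" "d \<ge> 1"
  shows "exp (real d / 16) * ((1 / sqrt (1 + 2 * \<theta> ^ L)) ^ d + real L * exp (- (\<theta> * (4 * real d * real L))))
       \<le> 2 * exp (- (real d / 4))"
proof -
  have "exp (5 / 8) \<le> exp (ln (2::real))"
    using ln2_ge_two_thirds by (subst exp_le_cancel_iff) linarith
  then have "exp (5 / 16) \<le> sqrt (2::real)"
    by (intro real_le_rsqrt) (simp flip: exp_double)
  then have "1 / sqrt 2 \<le> exp (- (5 / 16))"
    by (simp add: exp_minus field_simps)
  moreover have "1 / sqrt (1 + 2 * \<theta> ^ L) \<le> 1 / sqrt 2"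
    using assms(2) by (intro divide_left_mono) auto
  ultimately have "(1 / sqrt (1 + 2 * \<theta> ^ L)) ^ d \<le> exp (- (5 / 16)) ^ d"
    using assms(2) by (intro power_mono) auto
  also have "\<dots> = exp (- (5 * real d / 16))" by (simp flip: exp_of_nat_mult)
  finally have 1: "exp (real d / 16) * (1 / sqrt (1 + 2 * \<theta> ^ L)) ^ d \<le> exp (- (real d / 4))"
    using mult_left_mono[of _ "exp (- (5 * real d / 16))" "exp (real d / 16)"]
    by (simp add: mult_exp_exp)
  have "real L * exp (- (\<theta> * (4 * real d * real L))) \<le> exp (real L) * exp (- (1 / 2 * (4 * real d * real L)))"
  proof (rule mult_mono)
    show "real L \<le> exp (real L)"
      using exp_ge_add_one_self[of "real L"] by linarith
    show "exp (- (\<theta> * (4 * real d * real L))) \<le> exp (- (1 / 2 * (4 * real d * real L)))"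
      unfolding exp_le_cancel_iff neg_le_iff_le using assms(1) by (intro mult_right_mono) auto
  qed auto
  also have "\<dots> \<le> exp (- real d)"
  proof -
    have "real L * 1 \<le> real L * real d" "real d * 1 \<le> real d * real L"
      using assms(3,4) by (intro mult_left_mono; simp)+
    then show ?thesis by (simp add: mult_exp_exp algebra_simps)
  qed
  finally have "exp (real d / 16) * (real L * exp (- (\<theta> * (4 * real d * real L)))) \<le> exp (real d / 16) * exp (- real d)"
    by (intro mult_left_mono) auto
  also have "\<dots> \<le> exp (- (real d / 4))" by (simp add: mult_exp_exp)
  finally show ?thesis using 1 by (simp add: distrib_left)
qed

subsection \<open>Measurability of the Lipschitz constant\<close>

lemma floor_grid_LIMSEQ: "(\<lambda>n. of_int \<lfloor>real (Suc n) * x\<rfloor> / real (Suc n)) \<longlonglongrightarrow> x"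
proof (rule tendsto_sandwich)
  show "\<forall>\<^sub>F n in sequentially. x - 1 / real (Suc n) \<le> of_int \<lfloor>real (Suc n) * x\<rfloor> / real (Suc n)"
  proof (rule always_eventually, rule allI)
    fix n
    have "(real (Suc n) * x - 1) / real (Suc n) \<le> of_int \<lfloor>real (Suc n) * x\<rfloor> / real (Suc n)"
      by (rule divide_right_mono) linarith+
    then show "x - 1 / real (Suc n) \<le> of_int \<lfloor>real (Suc n) * x\<rfloor> / real (Suc n)"
      by (simp add: diff_divide_distrib del: of_nat_Suc)
  qed
  show "\<forall>\<^sub>F n in sequentially. of_int \<lfloor>real (Suc n) * x\<rfloor> / real (Suc n) \<le> x"
  proof (rule always_eventually, rule allI)
    fix n
    have "of_int \<lfloor>real (Suc n) * x\<rfloor> / real (Suc n) \<le> (real (Suc n) * x) / real (Suc n)"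
      by (rule divide_right_mono) linarith+
    then show "of_int \<lfloor>real (Suc n) * x\<rfloor> / real (Suc n) \<le> x"
      by (simp del: of_nat_Suc)
  qed
  show "(\<lambda>n. x - 1 / real (Suc n)) \<longlonglongrightarrow> x"
    using tendsto_diff[OF tendsto_const[of x] LIMSEQ_inverse_real_of_nat] by (simp add: inverse_eq_divide)
qed simp

text \<open>By continuity the supremum may be taken over the countably many pairs of points with
  rational coordinates.\<close>
lemma borel_measurable_Lip:
  assumes f [measurable]: "\<And>x. (\<lambda>\<omega>. f \<omega> x) \<in> borel_measurable M"
    and cont: "\<And>\<omega>. continuous_on UNIV (f \<omega>)"
  shows "(\<lambda>\<omega>. Lip d (f \<omega>)) \<in> borel_measurable M"
proof -
  \<comment> \<open>\<open>q (n, l)\<close> is the point of the grid of mesh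
    \<open>1 / (n + 1)\<close> with integer numerators \<open>l\<close>; the parameters form a
    countable type.\<close>
  define q :: "nat \<times> int list \<Rightarrow> nat \<Rightarrow> real"
    where "q = (\<lambda>(n, l) k. if k < d then of_int (l ! k) / real (Suc n) else 0)"
  define r where "r \<omega> p = ennreal (\<bar>f \<omega> (fst p) - f \<omega> (snd p)\<bar> / euclid_dist d (fst p) (snd p))"
    for \<omega> and p :: "(nat \<Rightarrow> real) \<times> (nat \<Rightarrow> real)"
  define Q where "Q = {p \<in> range (map_prod q q). fst p \<noteq> snd p}"
  have "Lip d (f \<omega>) = (SUP p\<in>Q. r \<omega> p)" for \<omega>
  proof (rule antisym)
    show "(SUP p\<in>Q. r \<omega> p) \<le> Lip d (f \<omega>)"
      unfolding Lip_def r_def by (rule SUP_subset_mono) (auto simp: Q_def q_def Rd_def)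
  next
    show "Lip d (f \<omega>) \<le> (SUP p\<in>Q. r \<omega> p)"
      unfolding Lip_def
    proof (rule SUP_least, clarsimp)
      fix x y assume xy: "x \<in> Rd d" "y \<in> Rd d" "x \<noteq> y"
      define a where "a z n = q (n, map (\<lambda>k. \<lfloor>real (Suc n) * z k\<rfloor>) [0..<d])" for z n
      have a_lim: "(\<lambda>n. a z n k) \<longlonglongrightarrow> z k" if "z \<in> Rd d" for z k
        using floor_grid_LIMSEQ[of "z k"] that by (cases "k < d") (auto simp: a_def q_def Rd_def)
      have f_lim: "(\<lambda>n. f \<omega> (a z n)) \<longlonglongrightarrow> f \<omega> z" if "z \<in> Rd d" for z
      proof -
        \<comment> \<open>Continuity on \<open>nat \<Rightarrow> real\<close> refers to the product
          topology, so coordinatewise convergence of the grid points suffices.\<close>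
        have "(\<lambda>n. a z n) \<longlonglongrightarrow> z"
        proof -
          have "limitin (product_topology (\<lambda>_. euclidean) UNIV) (\<lambda>n. a z n) z sequentially"
            unfolding limitin_componentwise using a_lim[OF that] by simp
          then show ?thesis by (simp add: euclidean_product_topology)
        qed
        with cont[of \<omega>] show ?thesis
          by (intro isCont_tendsto_compose[where g = "f \<omega>"]) (simp_all add: continuous_on_eq_continuous_at)
      qed
      have dist_lim: "(\<lambda>n. euclid_dist d (a x n) (a y n)) \<longlonglongrightarrow> euclid_dist d x y"
        unfolding euclid_dist_def by (intro tendsto_intros a_lim xy)
      have "euclid_dist d x y \<noteq> 0"
        using xy by (auto simp: euclid_dist_def sum_nonneg_eq_0_iff Rd_def fun_eq_iff) (metis lessThan_iff leI)
      then have pos: "euclid_dist d x y > 0"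
        by (simp add: euclid_dist_def sum_nonneg order_less_le)
      have "(\<lambda>n. r \<omega> (a x n, a y n)) \<longlonglongrightarrow> r \<omega> (x, y)"
        unfolding r_def fst_conv snd_conv using xy pos by (intro tendsto_intros f_lim dist_lim) auto
      \<comment> \<open>The limiting distance is positive, so the two approximants eventually differ
        and the pair belongs to \<open>Q\<close>.\<close>
      moreover have "\<forall>\<^sub>F n in sequentially. r \<omega> (a x n, a y n) \<le> (SUP p\<in>Q. r \<omega> p)"
        using order_tendstoD(1)[OF dist_lim pos]
      proof eventually_elim
        case (elim n)
        then have "a x n \<noteq> a y n" by (auto simp: euclid_dist_def)
        then have "(a x n, a y n) \<in> Q" unfolding Q_def a_def by (force simp: image_iff)
        then show ?case by (rule SUP_upper)
      qed
      ultimately have "r \<omega> (x, y) \<le> (SUP p\<in>Q. r \<omega> p)"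
        by (rule tendsto_upperbound) simp
      then show "ennreal (\<bar>f \<omega> x - f \<omega> y\<bar> / euclid_dist d x y) \<le> (SUP p\<in>Q. r \<omega> p)"
        by (simp add: r_def)
    qed
  qed
  moreover have "countable Q" unfolding Q_def by (rule countable_subset[of _ "range (map_prod q q)"]) auto
  ultimately show ?thesis unfolding r_def by (simp add: borel_measurable_SUP)
qed

subsection \<open>Networks and their tangent maps\<close>

locale relu_net =
  fixes d N L :: nat and D :: "nat \<Rightarrow> nat \<Rightarrow> real measure"
  assumes N_pos: "N \<ge> 1" and symmetric_bias: "\<And>l i. symmetric_dist (D l i)"
begin

abbreviation "P \<equiv> param_dist N L D"

text \<open>This is the input dimension of layer \<open>l\<close>, not its number of
  neurons.\<close>

definition width :: "nat \<Rightarrow> nat" where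
  "width l = (if l = 0 then d else N)"

text \<open>The bias belongs to the block, so that negating the block negates the whole
  pre-activation.\<close>

definition row :: "nat \<Rightarrow> nat \<Rightarrow> param set" where
  "row l i = insert (Bs l i) (Wt l i ` {..<width l})"

definition layer :: "nat \<Rightarrow> param set" where
  "layer l = (\<Union>i<N. row l i)"

text \<open>Only layers strictly before \<open>l\<close> are collected: these are the parameters
  that determine \<open>act x \<omega> l\<close> and \<open>tang x z \<omega> l\<close>.\<close>

definition layers :: "nat \<Rightarrow> param set" where
  "layers l = (\<Union>m<l. layer m)"

definition lin :: "(param \<Rightarrow> real) \<Rightarrow> nat \<Rightarrow> (nat \<Rightarrow> real) \<Rightarrow> nat \<Rightarrow> real" where
  "lin \<omega> l u i = (\<Sum>j<width l. \<omega> (Wt l i j) * u j)"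

definition pre :: "(param \<Rightarrow> real) \<Rightarrow> nat \<Rightarrow> (nat \<Rightarrow> real) \<Rightarrow> nat \<Rightarrow> real" where
  "pre \<omega> l y i = lin \<omega> l y i + \<omega> (Bs l i)"

text \<open>\<open>act x \<omega> l\<close> is the input of layer \<open>l\<close>, so that \<open>hidden\<close> at \<open>l\<close> is \<open>act\<close> at \<open>Suc l\<close>.\<close>
primrec act :: "(nat \<Rightarrow> real) \<Rightarrow> (param \<Rightarrow> real) \<Rightarrow> nat \<Rightarrow> nat \<Rightarrow> real" where
  "act x \<omega> 0 = x"
| "act x \<omega> (Suc l) = (\<lambda>i. if i < N then relu (pre \<omega> l (act x \<omega> l) i) else 0)"

text \<open>The derivative of \<open>act\<close> at \<open>x\<close> in direction \<open>z\<close>, with \<open>relu' 0 = 0\<close>.\<close>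
primrec tang :: "(nat \<Rightarrow> real) \<Rightarrow> (nat \<Rightarrow> real) \<Rightarrow> (param \<Rightarrow> real) \<Rightarrow> nat \<Rightarrow> nat \<Rightarrow> real" where
  "tang x z \<omega> 0 = z"
| "tang x z \<omega> (Suc l) = (\<lambda>i. if i < N \<and> pre \<omega> l (act x \<omega> l) i > 0 then lin \<omega> l (tang x z \<omega> l) i else 0)"

lemma hidden_eq_act: "hidden \<omega> d N l x = act x \<omega> (Suc l)"
  by (induction l) (auto simp: pre_def lin_def width_def)

lemma net_eq_act: "L \<ge> 1 \<Longrightarrow> net \<omega> d N L x = (\<Sum>j<N. \<omega> (Wt L 0 j) * act x \<omega> L j) + \<omega> (Bs L 0)"
  unfolding net_def hidden_eq_act by simp

lemma finite_row [simp]: "finite (row l i)"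
  and finite_layer [simp]: "finite (layer l)"
  and finite_layers [simp]: "finite (layers l)"
  by (auto simp: row_def layer_def layers_def)

lemma layers_0 [simp]: "layers 0 = {}"
  by (simp add: layers_def)

lemma layers_Suc: "layers (Suc l) = layers l \<union> layer l"
  by (auto simp: layers_def lessThan_Suc)

lemma layers_layer_disjoint: "layers l \<inter> layer l = {}"
  by (auto simp: layers_def layer_def row_def)

lemma Wt_in_layers [simp]: "Wt m i j \<in> layers l \<longleftrightarrow> m < l \<and> i < N \<and> j < width m"
  and Bs_in_layers [simp]: "Bs m i \<in> layers l \<longleftrightarrow> m < l \<and> i < N"
  by (auto simp: layers_def layer_def row_def)

lemma param_set_eq:
  assumes "L \<ge> 1"
  shows "param_set d N L = layers L \<union> insert (Bs L 0) (Wt L 0 ` {..<N})"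
proof (rule set_eqI)
  show "p \<in> param_set d N L \<longleftrightarrow> p \<in> layers L \<union> insert (Bs L 0) (Wt L 0 ` {..<N})" for p
    using assms by (cases p) (auto simp: param_set_def width_def)
qed

lemma lin_cong:
  assumes "\<And>j. j < width l \<Longrightarrow> \<omega> (Wt l i j) = \<omega>' (Wt l i j)" "\<And>j. j < width l \<Longrightarrow> u j = u' j"
  shows "lin \<omega> l u i = lin \<omega>' l u' i"
  using assms by (simp add: lin_def)

lemma pre_cong:
  assumes "\<And>p. p \<in> row l i \<Longrightarrow> \<omega> p = \<omega>' p" "\<And>j. j < width l \<Longrightarrow> y j = y' j"
  shows "pre \<omega> l y i = pre \<omega>' l y' i"
  unfolding pre_def using assms by (intro arg_cong2[of _ _ _ _ "(+)"] lin_cong) (auto simp: row_def)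

lemma row_subset_layers: "i < N \<Longrightarrow> row l i \<subseteq> layers (Suc l)"
  by (auto simp: layers_Suc layer_def)

lemma Wt_in_row: "j < width l \<Longrightarrow> Wt l i j \<in> row l i"
  by (simp add: row_def)

lemma act_cong: "(\<And>p. p \<in> layers l \<Longrightarrow> \<omega> p = \<omega>' p) \<Longrightarrow> act x \<omega> l = act x \<omega>' l"
proof (induction l)
  case (Suc l)
  then have "act x \<omega> l = act x \<omega>' l" by (auto simp: layers_Suc)
  moreover have "pre \<omega> l y i = pre \<omega>' l y i" if "i < N" for y i
    using Suc.prems row_subset_layers[OF that, of l] by (blast intro: pre_cong)
  ultimately show ?case by auto
qed simp

lemma tang_cong: "(\<And>p. p \<in> layers l \<Longrightarrow> \<omega> p = \<omega>' p) \<Longrightarrow> tang x z \<omega> l = tang x z \<omega>' l"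
proof (induction l)
  case (Suc l)
  then have "tang x z \<omega> l = tang x z \<omega>' l" by (auto simp: layers_Suc)
  moreover have "act x \<omega> l = act x \<omega>' l"
    using Suc.prems by (intro act_cong) (auto simp: layers_Suc)
  moreover have "pre \<omega> l y i = pre \<omega>' l y i" "lin \<omega> l y i = lin \<omega>' l y i" if "i < N" for y i
    using Suc.prems row_subset_layers[OF that, of l] Wt_in_row
    by (blast intro: pre_cong lin_cong)+
  ultimately show ?case by (intro ext) auto
qed simp

text \<open>If all neurons of a layer are inactive, the next pre-activations reduce to the biases and may
  vanish with positive probability; this is harmless because the tangent is then zero as well.\<close>
lemma tang_eq_0:
  assumes "\<And>j. j < N \<Longrightarrow> act x \<omega> (Suc l) j = 0"
  shows "tang x z \<omega> (Suc l) j = 0"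
  using assms[of j] by (auto simp: relu_def max_def split: if_splits)

text \<open>Linearity in the direction: the tangents of the unit vectors are the columns of the
  Jacobian. The bound on \<open>i\<close> matters at layer 0, where \<open>z\<close> may have
  nonzero coordinates from \<open>d\<close> on.\<close>

lemma tang_sum: "i < width l \<Longrightarrow> tang x z \<omega> l i = (\<Sum>k<d. z k * tang x (\<lambda>j. if j = k then 1 else 0) \<omega> l i)"
proof (induction l arbitrary: i)
  case 0
  then show ?case by (simp add: width_def if_distrib[of "(*) _"] cong: if_cong)
next
  case (Suc l)
  have "lin \<omega> l (tang x z \<omega> l) i = (\<Sum>k<d. z k * lin \<omega> l (tang x (\<lambda>j. if j = k then 1 else 0) \<omega> l) i)"
    unfolding lin_def by (simp add: Suc.IH sum_distrib_left mult_ac) (rule sum.swap)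
  then show ?case by auto
qed

subsection \<open>Random layers\<close>

lemma prob_space_P [simp]: "prob_space (P p)"
  using symmetric_bias N_pos
  by (auto simp: param_dist_def symmetric_dist_def intro!: prob_space_gauss split: param.split)

lemma symmetric_P: "symmetric_dist (P p)"
  using symmetric_bias N_pos
  by (auto simp: param_dist_def intro!: symmetric_dist_gauss split: param.split)

lemma sets_P [simp, measurable_cong]: "sets (P p) = sets borel"
  using symmetric_P by (auto simp: symmetric_dist_def)

lemma P_Wt: "l < L \<Longrightarrow> P (Wt l i j) = gauss (sqrt (2 / N))" "P (Wt L i j) = gauss 1"
  by (auto simp: param_dist_def)

lemma prob_space_PiM_P: "prob_space (PiM I P)"
  by (intro prob_space_PiM prob_space_P)

lemma measurable_param [measurable]: "(\<lambda>\<omega>. \<omega> p) \<in> borel_measurable (PiM I P)"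
  by (rule measurable_PiM_real_component) simp

lemma measurable_relu [measurable]: "relu \<in> borel_measurable borel"
  unfolding relu_def by measurable

lemma measurable_lin [measurable (raw)]:
  assumes "f \<in> measurable M (PiM I P)" "\<And>j. (\<lambda>w. u w j) \<in> borel_measurable M"
  shows "(\<lambda>w. lin (f w) l (u w) i) \<in> borel_measurable M"
  unfolding lin_def using assms measurable_compose[OF assms(1) measurable_param]
  by (intro borel_measurable_sum borel_measurable_times) auto

lemma measurable_pre [measurable (raw)]:
  assumes "f \<in> measurable M (PiM I P)" "\<And>j. (\<lambda>w. u w j) \<in> borel_measurable M"
  shows "(\<lambda>w. pre (f w) l (u w) i) \<in> borel_measurable M"
  unfolding pre_def using assms measurable_compose[OF assms(1) measurable_param]
  by (intro borel_measurable_add measurable_lin) auto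

lemma measurable_act [measurable]: "(\<lambda>\<omega>. act x \<omega> l i) \<in> borel_measurable (PiM I P)"
proof (induction l arbitrary: i)
  case (Suc l)
  have "(\<lambda>\<omega>. pre \<omega> l (act x \<omega> l) i) \<in> borel_measurable (PiM I P)"
    by (rule measurable_pre[of "\<lambda>w. w" _ I]) (use Suc in auto)
  then show ?case by simp
qed simp

lemma measurable_tang [measurable]: "(\<lambda>w. tang x (z w) (\<omega> w) l i) \<in> borel_measurable M"
  if "\<omega> \<in> measurable M (PiM I P)" "\<And>j. (\<lambda>w. z w j) \<in> borel_measurable M"
proof (induction l arbitrary: i)
  case (Suc l)
  have [measurable]: "(\<lambda>w. pre (\<omega> w) l (act x (\<omega> w) l) i) \<in> borel_measurable M"
    by (rule measurable_pre[of \<omega> _ I]) (use that(1) measurable_compose[OF that(1) measurable_act] in auto)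
  have [measurable]: "(\<lambda>w. lin (\<omega> w) l (tang x (z w) (\<omega> w) l) i) \<in> borel_measurable M"
    by (rule measurable_lin[of \<omega> _ I]) (use that Suc in auto)
  show ?case by simp
qed (use that in simp)

lemma measurable_tang_const [measurable]: "(\<lambda>\<omega>. tang x z \<omega> l i) \<in> borel_measurable (PiM I P)"
  by (rule measurable_tang[of _ _ I]) auto

lemma sum_Wt_row: "(\<Sum>p\<in>Wt l i ` {..<n}. f p) = (\<Sum>j<n. f (Wt l i j))"
  by (subst sum.reindex) (auto simp: inj_on_def)

text \<open>\<open>lin\<close> ignores the bias, so it suffices to integrate over the weights, a
  Gaussian vector. The weight variance \<open>2 / N\<close> produces the factor 4.\<close>

lemma nn_integral_row_exp_lin:
  assumes "l < L" "s \<ge> 0"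
  shows "(\<integral>\<^sup>+\<omega>. ennreal (exp (- (s * (lin \<omega> l u i)\<^sup>2))) \<partial>PiM (row l i) P)
       = ennreal (1 / sqrt (1 + 4 * (s * (\<Sum>j<width l. (u j)\<^sup>2)) / N))"
proof -
  define W where "W = Wt l i ` {..<width l}"
  define v where "v p = (case p of Wt l i j \<Rightarrow> u j | Bs l i \<Rightarrow> 0)" for p
  have lin: "lin \<omega> l u i = (\<Sum>p\<in>W. \<omega> p * v p)" for \<omega>
    by (simp add: W_def sum_Wt_row lin_def v_def)
  have v: "(\<Sum>j<width l. (u j)\<^sup>2) = (\<Sum>p\<in>W. (v p)\<^sup>2)"
    by (simp add: W_def sum_Wt_row v_def)
  have "(\<integral>\<^sup>+\<omega>. ennreal (exp (- (s * (lin \<omega> l u i)\<^sup>2))) \<partial>PiM (row l i) P)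
      = (\<integral>\<^sup>+\<omega>. ennreal (exp (- (s * (\<Sum>p\<in>W. restrict \<omega> W p * v p)\<^sup>2))) \<partial>PiM (row l i) P)"
    by (simp add: lin)
  also have "\<dots> = (\<integral>\<^sup>+\<omega>. ennreal (exp (- (s * (\<Sum>p\<in>W. \<omega> p * v p)\<^sup>2))) \<partial>PiM W P)"
    by (rule nn_integral_PiM_restrict) (auto simp: W_def row_def)
  also have "PiM W P = PiM W (\<lambda>_. gauss (sqrt (2 / N)))"
    using assms by (intro PiM_cong) (auto simp: W_def P_Wt)
  also have "(\<integral>\<^sup>+\<omega>. ennreal (exp (- (s * (\<Sum>p\<in>W. \<omega> p * v p)\<^sup>2))) \<partial>PiM W (\<lambda>_. gauss (sqrt (2 / N))))
      = ennreal (1 / sqrt (1 + 4 * (s * (\<Sum>p\<in>W. (v p)\<^sup>2)) / N))"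
    using assms N_pos by (subst nn_integral_PiM_gauss_linear) (auto simp: W_def mult_ac)
  finally show ?thesis by (simp add: v)
qed

lemma AE_Wt_neq: "l < L \<Longrightarrow> AE v in P (Wt l i j). v \<noteq> c"
  using N_pos unfolding P_Wt(1) by (intro AE_gauss_neq) simp

text \<open>The pre-activation is affine in the single Gaussian weight \<open>Wt l i j\<close> with
  slope \<open>y \<omega> j\<close>. The vector \<open>y\<close> may be random, as are the
  activations of earlier layers, provided it does not depend on that weight.\<close>

lemma AE_pre_neq_0:
  assumes l: "l < L" and j: "j < width l" and I: "finite I" "Wt l i j \<in> I"
    and [measurable]: "\<And>k. (\<lambda>\<omega>. y \<omega> k) \<in> borel_measurable (PiM I P)"
    and upd: "\<And>\<omega> v. y (fun_upd \<omega> (Wt l i j) v) = y \<omega>"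
  shows "AE \<omega> in PiM I P. y \<omega> j \<noteq> 0 \<longrightarrow> pre \<omega> l (y \<omega>) i \<noteq> 0"
proof -
  define c where "c \<omega> = (\<Sum>k\<in>{..<width l} - {j}. \<omega> (Wt l i k) * y \<omega> k) + \<omega> (Bs l i)" for \<omega>
  have pre: "pre \<omega> l (y \<omega>) i = \<omega> (Wt l i j) * y \<omega> j + c \<omega>" for \<omega>
    unfolding pre_def lin_def c_def using j by (simp add: sum.remove[of "{..<width l}" j])
  have "AE \<omega> in PiM I P. y \<omega> j \<noteq> 0 \<longrightarrow> \<omega> (Wt l i j) * y \<omega> j + c \<omega> \<noteq> 0"
  proof (rule AE_PiM_affine_neq_0)
    show "c \<in> borel_measurable (PiM I P)" unfolding c_def by measurable
    show "c (fun_upd \<omega> (Wt l i j) v) = c \<omega>" for \<omega> v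
      unfolding c_def upd by (auto intro!: sum.cong)
  qed (use l I in \<open>auto simp: upd intro: AE_Wt_neq\<close>)
  then show ?thesis by (simp add: pre)
qed

lemma sign_flip:
  "lin (\<lambda>p\<in>row l i. - \<omega> p) l u i = - lin \<omega> l u i"
  "pre (\<lambda>p\<in>row l i. - \<omega> p) l y i = - pre \<omega> l y i"
  by (auto simp: pre_def lin_def row_def sum_negf)

text \<open>Flipping the sign of a whole row preserves its distribution and swaps active and inactive,
  so the row is active with probability 1/2 independently of \<open>(lin \<omega> l u i)\<^sup>2\<close>.\<close>
lemma nn_integral_row_le:
  assumes l: "l < L" and s: "s \<ge> 0"
    and nz: "(\<exists>j<width l. y j \<noteq> 0) \<or> (\<forall>j<width l. u j = 0)"
  shows "(\<integral>\<^sup>+\<omega>. ennreal (exp (- (s * (if pre \<omega> l y i > 0 then lin \<omega> l u i else 0)\<^sup>2))) \<partial>PiM (row l i) P)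
       \<le> ennreal ((1 + 1 / sqrt (1 + 4 * (s * (\<Sum>j<width l. (u j)\<^sup>2)) / N)) / 2)" (is "?E \<le> ennreal (?B / 2)")
proof -
  interpret prob_space "PiM (row l i) P" by (rule prob_space_PiM_P)
  have [measurable]: "(\<lambda>\<omega>. pre \<omega> l y i) \<in> borel_measurable (PiM (row l i) P)"
    "(\<lambda>\<omega>. lin \<omega> l u i) \<in> borel_measurable (PiM (row l i) P)"
    by (auto intro!: measurable_pre[of _ _ "row l i"] measurable_lin[of _ _ "row l i"])
  have flip: "?E = (\<integral>\<^sup>+\<omega>. ennreal (exp (- (s * (if pre \<omega> l y i < 0 then lin \<omega> l u i else 0)\<^sup>2))) \<partial>PiM (row l i) P)"
    by (subst nn_integral_PiM_uminus[symmetric])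
       (auto simp: symmetric_P sign_flip if_distrib[of "\<lambda>x. x\<^sup>2"] cong: if_cong)
  \<comment> \<open>A vanishing pre-activation would count as inactive on both sides of the sign
    flip; by \<open>nz\<close> this almost surely happens only when \<open>lin\<close> is zero
    too.\<close>
  have AE: "AE \<omega> in PiM (row l i) P. pre \<omega> l y i \<noteq> 0 \<or> lin \<omega> l u i = 0"
    using nz
  proof
    assume "\<exists>j<width l. y j \<noteq> 0"
    then obtain j where "j < width l" "y j \<noteq> 0" by auto
    with AE_pre_neq_0[OF l, of j "row l i" i "\<lambda>_. y"] show ?thesis
      by (auto simp: Wt_in_row elim!: eventually_mono)
  qed (simp add: lin_def)
  have "?E + ?E = (\<integral>\<^sup>+\<omega>. ennreal (exp (- (s * (if pre \<omega> l y i > 0 then lin \<omega> l u i else 0)\<^sup>2)))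
      + ennreal (exp (- (s * (if pre \<omega> l y i < 0 then lin \<omega> l u i else 0)\<^sup>2))) \<partial>PiM (row l i) P)"
    by (subst (2) flip, rule nn_integral_add[symmetric]) measurable
  \<comment> \<open>Exactly one of the two conditions holds when the pre-activation is nonzero, so
    one exponential is the full one and the other is 1. Otherwise \<open>lin\<close> is zero and
    both equal 1.\<close>
  also have "\<dots> = (\<integral>\<^sup>+\<omega>. 1 + ennreal (exp (- (s * (lin \<omega> l u i)\<^sup>2))) \<partial>PiM (row l i) P)"
    by (rule nn_integral_cong_AE) (use AE in eventually_elim, auto simp: add.commute)
  also have "\<dots> = 1 + ennreal (1 / sqrt (1 + 4 * (s * (\<Sum>j<width l. (u j)\<^sup>2)) / N))"
    by (subst nn_integral_add) (simp_all add: nn_integral_row_exp_lin[OF l s] emeasure_space_1)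
  also have "\<dots> = ennreal ?B"
    using s by (subst ennreal_plus) (auto intro!: sum_nonneg add_nonneg_nonneg divide_nonneg_nonneg mult_nonneg_nonneg)
  also have "ennreal ?B = 2 * ennreal (?B / 2)"
  proof -
    have "?B \<ge> 0"
      using s by (auto intro!: sum_nonneg add_nonneg_nonneg divide_nonneg_nonneg mult_nonneg_nonneg)
    then show ?thesis unfolding mult_2 by (subst ennreal_plus[symmetric]) auto
  qed
  finally have "2 * ?E = 2 * ennreal (?B / 2)" unfolding mult_2 .
  then have "?E = ennreal (?B / 2)"
    using ennreal_mult_cancel_left[of 2 ?E "ennreal (?B / 2)"] by simp
  then show ?thesis by simp
qed

text \<open>The rows are disjoint blocks, so the expectation factorises into \<open>N\<close> copies
  of the bound for one row, to which \<open>layer_laplace_bound\<close> applies with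
  \<open>y\<close> equal to \<open>s\<close> times the squared norm of \<open>u\<close>.\<close>

lemma nn_integral_layer_le:
  fixes Y :: real
  assumes l: "l < L" and s: "s \<ge> 0" and Y: "Y \<ge> 0"
    and nz: "(\<exists>j<width l. y j \<noteq> 0) \<or> (\<forall>j<width l. u j = 0)"
  defines "\<theta> \<equiv> 1 - 3 * Y / N"
  shows "(\<integral>\<^sup>+\<omega>. ennreal (exp (- (s * (\<Sum>i<N. (if pre \<omega> l y i > 0 then lin \<omega> l u i else 0)\<^sup>2)))) \<partial>PiM (layer l) P)
       \<le> ennreal (exp (- (s * \<theta> * (\<Sum>j<width l. (u j)\<^sup>2))) + exp (- (\<theta> * Y)))"
proof -
  define f where "f i \<omega> = ennreal (exp (- (s * (if pre \<omega> l y i > 0 then lin \<omega> l u i else 0)\<^sup>2)))" for i \<omega>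
  have [measurable]: "(\<lambda>\<omega>. pre \<omega> l y i) \<in> borel_measurable (PiM I P)"
    "(\<lambda>\<omega>. lin \<omega> l u i) \<in> borel_measurable (PiM I P)" for I i
    by (auto intro!: measurable_pre[of _ _ I] measurable_lin[of _ _ I])
  have loc: "f i (restrict \<omega> (row l i)) = f i \<omega>" for i \<omega>
    by (simp add: f_def pre_def lin_def row_def)
  have "(\<integral>\<^sup>+\<omega>. ennreal (exp (- (s * (\<Sum>i<N. (if pre \<omega> l y i > 0 then lin \<omega> l u i else 0)\<^sup>2)))) \<partial>PiM (layer l) P)
      = (\<integral>\<^sup>+\<omega>. (\<Prod>i<N. f i (restrict \<omega> (row l i))) \<partial>PiM (\<Union>i<N. row l i) P)"
    unfolding loc by (simp add: f_def layer_def prod_ennreal sum_distrib_left flip: exp_sum sum_negf)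
  also have "\<dots> = (\<Prod>i<N. \<integral>\<^sup>+\<omega>. f i \<omega> \<partial>PiM (row l i) P)"
  proof (rule nn_integral_PiM_blocks)
    show "f i \<in> borel_measurable (PiM (row l i) P)" for i unfolding f_def by measurable
    show "disjoint_family_on (row l) {..<N}" by (auto simp: disjoint_family_on_def row_def)
  qed auto
  also have "\<dots> \<le> (\<Prod>i<N. ennreal ((1 + 1 / sqrt (1 + 4 * (s * (\<Sum>j<width l. (u j)\<^sup>2)) / N)) / 2))"
    unfolding f_def by (intro prod_mono_ennreal nn_integral_row_le l s nz)
  also have "\<dots> = ennreal (((1 + 1 / sqrt (1 + 4 * (s * (\<Sum>j<width l. (u j)\<^sup>2)) / N)) / 2) ^ N)"
    using s by (simp add: ennreal_power sum_nonneg)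
  also have "\<dots> \<le> ennreal (exp (- (s * \<theta> * (\<Sum>j<width l. (u j)\<^sup>2))) + exp (- (\<theta> * Y)))"
    using layer_laplace_bound[of "s * (\<Sum>j<width l. (u j)\<^sup>2)" Y N] s Y N_pos
    by (intro ennreal_leI) (simp add: \<theta>_def sum_nonneg mult_ac)
  finally show ?thesis .
qed

text \<open>Induction with \<open>s\<close> arbitrary: given the earlier layers, integrating out the
  last one replaces \<open>s\<close> by \<open>s * \<theta>\<close> and adds one error
  \<open>exp (- (\<theta> * Y))\<close>. The bound \<open>3 * Y \<le> N\<close> keeps
  \<open>s * \<theta>\<close> nonnegative.\<close>

lemma nn_integral_tang_le:
  fixes Y :: real
  assumes "l \<le> L" and s: "s \<ge> 0" and Y: "Y \<ge> 0" "3 * Y \<le> N" and x: "\<exists>j<d. x j \<noteq> 0"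
  defines "\<theta> \<equiv> 1 - 3 * Y / N"
  shows "(\<integral>\<^sup>+\<omega>. ennreal (exp (- (s * (\<Sum>i<width l. (tang x z \<omega> l i)\<^sup>2)))) \<partial>PiM (layers l) P)
       \<le> ennreal (exp (- (s * \<theta> ^ l * (\<Sum>k<d. (z k)\<^sup>2))) + real l * exp (- (\<theta> * Y)))"
  using assms(1) s
proof (induction l arbitrary: s)
  case 0
  interpret prob_space "PiM {} P" by (rule prob_space_PiM_P)
  show ?case by (simp add: emeasure_space_1 width_def)
next
  case (Suc l)
  interpret product_prob_space P "layers (Suc l)" by (rule product_prob_spaceI) simp
  interpret l: prob_space "PiM (layers l) P" by (rule prob_space_PiM_P)
  have \<theta>: "\<theta> \<ge> 0" using Y N_pos by (simp add: \<theta>_def)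
  define F where "F \<omega> = ennreal (exp (- (s * (\<Sum>i<N. (tang x z \<omega> (Suc l) i)\<^sup>2))))" for \<omega>
  have F [measurable]: "F \<in> borel_measurable (PiM (layers l \<union> layer l) P)"
    unfolding F_def by measurable
  have "(\<integral>\<^sup>+\<omega>. ennreal (exp (- (s * (\<Sum>i<width (Suc l). (tang x z \<omega> (Suc l) i)\<^sup>2)))) \<partial>PiM (layers (Suc l)) P)
      = (\<integral>\<^sup>+\<omega>. F \<omega> \<partial>PiM (layers l \<union> layer l) P)"
    by (simp only: F_def layers_Suc width_def) simp
  also have "\<dots> = (\<integral>\<^sup>+\<omega>. (\<integral>\<^sup>+\<omega>'. F (merge (layers l) (layer l) (\<omega>, \<omega>')) \<partial>PiM (layer l) P) \<partial>PiM (layers l) P)"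
    by (intro product_nn_integral_fold layers_layer_disjoint F) auto
  also have "\<dots> \<le> (\<integral>\<^sup>+\<omega>. ennreal (exp (- (s * \<theta> * (\<Sum>i<width l. (tang x z \<omega> l i)\<^sup>2))))
      + ennreal (exp (- (\<theta> * Y))) \<partial>PiM (layers l) P)"
  proof (rule nn_integral_mono)
    fix \<omega>
    have "F (merge (layers l) (layer l) (\<omega>, \<omega>'))
        = ennreal (exp (- (s * (\<Sum>i<N. (if pre \<omega>' l (act x \<omega> l) i > 0 then lin \<omega>' l (tang x z \<omega> l) i else 0)\<^sup>2))))" for \<omega>'
    proof -
      let ?m = "merge (layers l) (layer l) (\<omega>, \<omega>')"
      have m: "?m p = \<omega>' p" if "p \<in> row l i" "i < N" for p i
        using that layers_layer_disjoint[of l] unfolding layer_def by (auto simp: merge_def)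
      have "act x ?m l = act x \<omega> l" by (rule act_cong) (auto simp: merge_def)
      moreover have "tang x z ?m l = tang x z \<omega> l" by (rule tang_cong) (auto simp: merge_def)
      moreover have "pre ?m l y i = pre \<omega>' l y i" if "i < N" for i y
        using m[OF _ that] by (auto intro: pre_cong)
      moreover have "lin ?m l u i = lin \<omega>' l u i" if "i < N" for i u
        using m[OF Wt_in_row that] by (auto intro: lin_cong)
      ultimately have "tang x z ?m (Suc l) i
          = (if pre \<omega>' l (act x \<omega> l) i > 0 then lin \<omega>' l (tang x z \<omega> l) i else 0)" if "i < N" for i
        using that by auto
      then show ?thesis unfolding F_def by (simp del: tang.simps)
    qed
    \<comment> \<open>Nondegeneracy for the layer bound: at the first layer it is \<open>x\<close>
      being nonzero, later a vanishing activation vector forces a vanishing tangent.\<close>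
    moreover have "(\<exists>j<width l. act x \<omega> l j \<noteq> 0) \<or> (\<forall>j<width l. tang x z \<omega> l j = 0)"
    proof (cases l)
      case 0
      then show ?thesis using x by (simp add: width_def)
    next
      case (Suc k)
      then show ?thesis using tang_eq_0[of x \<omega> k z] unfolding Suc width_def by fastforce
    qed
    ultimately show "(\<integral>\<^sup>+\<omega>'. F (merge (layers l) (layer l) (\<omega>, \<omega>')) \<partial>PiM (layer l) P)
        \<le> ennreal (exp (- (s * \<theta> * (\<Sum>i<width l. (tang x z \<omega> l i)\<^sup>2)))) + ennreal (exp (- (\<theta> * Y)))"
      using nn_integral_layer_le[of l s Y "act x \<omega> l" "tang x z \<omega> l"] Suc.prems Y
      by (simp add: \<theta>_def)
  qed
  also have "\<dots> = (\<integral>\<^sup>+\<omega>. ennreal (exp (- (s * \<theta> * (\<Sum>i<width l. (tang x z \<omega> l i)\<^sup>2)))) \<partial>PiM (layers l) P)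
      + ennreal (exp (- (\<theta> * Y)))"
    by (subst nn_integral_add) (simp_all add: l.emeasure_space_1)
  also have "\<dots> \<le> ennreal (exp (- (s * \<theta> * \<theta> ^ l * (\<Sum>k<d. (z k)\<^sup>2))) + real l * exp (- (\<theta> * Y)))
      + ennreal (exp (- (\<theta> * Y)))"
    using Suc.IH[of "s * \<theta>"] Suc.prems \<theta> by (intro add_right_mono) simp
  also have "\<dots> = ennreal (exp (- (s * \<theta> ^ Suc l * (\<Sum>k<d. (z k)\<^sup>2))) + real (Suc l) * exp (- (\<theta> * Y)))"
    by (subst ennreal_plus[symmetric]) (auto simp: algebra_simps)
  finally show ?case .
qed

subsection \<open>The gradient\<close>

lemma continuous_on_act: "continuous_on UNIV (\<lambda>x. act x \<omega> l i)"
proof (induction l arbitrary: i)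
  case 0
  show ?case by (simp add: continuous_on_product_coordinates)
next
  case (Suc l)
  show ?case
    unfolding act.simps pre_def lin_def relu_def
    by (cases "i < N") (auto intro!: continuous_intros Suc)
qed

lemma measurable_Lip_net:
  assumes "L \<ge> 1"
  shows "(\<lambda>\<omega>. Lip d (net \<omega> d N L)) \<in> borel_measurable (PiM I P)"
proof (rule borel_measurable_Lip)
  show "(\<lambda>\<omega>. net \<omega> d N L x) \<in> borel_measurable (PiM I P)" for x
    unfolding net_eq_act[OF assms] by measurable
  show "continuous_on UNIV (net \<omega> d N L)" for \<omega>
    unfolding net_eq_act[OF assms] by (intro continuous_intros continuous_on_act)
qed

text \<open>The chain-rule gradient of the network at \<open>x\<close>, that is the transposed
  Jacobian of the last hidden layer applied to the output weights.\<close>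

definition grad :: "(nat \<Rightarrow> real) \<Rightarrow> (param \<Rightarrow> real) \<Rightarrow> nat \<Rightarrow> real" where
  "grad x \<omega> k = (\<Sum>j<N. \<omega> (Wt L 0 j) * tang x (\<lambda>i. if i = k then 1 else 0) \<omega> L j)"

lemma measurable_grad [measurable]: "(\<lambda>\<omega>. grad x \<omega> k) \<in> borel_measurable (PiM I P)"
  unfolding grad_def by measurable

lemma lin_affine: "lin \<omega> l (\<lambda>j. u j + h * v j) i = lin \<omega> l u i + h * lin \<omega> l v i"
  by (simp add: lin_def algebra_simps sum.distrib sum_distrib_left)

text \<open>No neuron sits at the kink of ReLU, except where the incoming tangent vanishes in every
  direction, so that the kink is not left to first order.\<close>

definition regular :: "(nat \<Rightarrow> real) \<Rightarrow> (param \<Rightarrow> real) \<Rightarrow> bool" where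
  "regular x \<omega> \<longleftrightarrow> (\<forall>l<L. \<forall>i<N. pre \<omega> l (act x \<omega> l) i \<noteq> 0 \<or> (\<forall>j<width l. \<forall>v. tang x v \<omega> l j = 0))"

text \<open>Along a ray every pre-activation is affine for small steps, and a nonzero one keeps its
  sign, so ReLU acts linearly there. Hence the expansion is an exact equality, without
  remainder.\<close>

lemma eventually_act_affine:
  assumes "regular x \<omega>" "l \<le> L"
  shows "\<forall>\<^sub>F h in at_right 0. \<forall>i<width l. act (\<lambda>k. x k + h * v k) \<omega> l i = act x \<omega> l i + h * tang x v \<omega> l i"
  using assms(2)
proof (induction l)
  case (Suc l)
  let ?b = "\<lambda>i. pre \<omega> l (act x \<omega> l) i" and ?c = "\<lambda>i. lin \<omega> l (tang x v \<omega> l) i"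
  have relu: "\<forall>\<^sub>F h in at_right 0. relu (?b i + h * ?c i) = relu (?b i) + h * (if ?b i > 0 then ?c i else 0)"
    if i: "i < N" for i
  proof -
    have lim: "((\<lambda>h. ?b i + h * ?c i) \<longlongrightarrow> ?b i + 0 * ?c i) (at_right 0)"
      by (intro tendsto_intros)
    consider "?b i > 0" | "?b i < 0" | "?b i = 0" by linarith
    then show ?thesis
    proof cases
      case 1
      then have "\<forall>\<^sub>F h in at_right 0. ?b i + h * ?c i > 0"
        using order_tendstoD(1)[OF lim] by simp
      then show ?thesis by eventually_elim (use 1 in \<open>simp add: relu_def\<close>)
    next
      case 2
      then have "\<forall>\<^sub>F h in at_right 0. ?b i + h * ?c i < 0"
        using order_tendstoD(2)[OF lim] by simp
      then show ?thesis by eventually_elim (use 2 in \<open>simp add: relu_def\<close>)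
    next
      \<comment> \<open>At the kink regularity makes the slope zero, so the pre-activation stays at
        0 along the ray.\<close>
      case 3
      then have "?c i = 0"
        using assms(1) Suc.prems i unfolding regular_def lin_def by (auto intro!: sum.neutral)
      then show ?thesis by simp
    qed
  qed
  have "\<forall>\<^sub>F h in at_right 0. \<forall>i\<in>{..<N}. relu (?b i + h * ?c i) = relu (?b i) + h * (if ?b i > 0 then ?c i else 0)"
    using relu by (intro eventually_ball_finite) auto
  moreover have "\<forall>\<^sub>F h in at_right 0. \<forall>i<width l. act (\<lambda>k. x k + h * v k) \<omega> l i = act x \<omega> l i + h * tang x v \<omega> l i"
    using Suc by simp
  ultimately show ?case
  proof eventually_elim
    case (elim h)
    have "pre \<omega> l (act (\<lambda>k. x k + h * v k) \<omega> l) i = pre \<omega> l (\<lambda>j. act x \<omega> l j + h * tang x v \<omega> l j) i" for i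
      using elim(2) by (auto intro: pre_cong)
    then have "pre \<omega> l (act (\<lambda>k. x k + h * v k) \<omega> l) i = ?b i + h * ?c i" for i
      by (simp add: pre_def lin_affine)
    then show ?case using elim(1) by (auto simp: width_def)
  qed
qed simp

text \<open>Take one small step from \<open>x\<close> in the direction of the gradient. The network
  is affine on it, so the difference quotient equals the gradient norm and no limit is
  taken.\<close>

lemma Lip_ge_grad:
  assumes L: "L \<ge> 1" and reg: "regular x \<omega>" and x: "x \<in> Rd d"
  shows "ennreal (sqrt (\<Sum>k<d. (grad x \<omega> k)\<^sup>2)) \<le> Lip d (net \<omega> d N L)"
proof (cases "(\<Sum>k<d. (grad x \<omega> k)\<^sup>2) = 0")
  case False
  define G where "G = (\<Sum>k<d. (grad x \<omega> k)\<^sup>2)"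
  have G: "G > 0" using False unfolding G_def by (simp add: sum_nonneg order_less_le)
  \<comment> \<open>Cutting off at \<open>d\<close> keeps the second point inside
    \<open>Rd d\<close>.\<close>
  define v where "v k = (if k < d then grad x \<omega> k else 0)" for k
  have w: "width L = N" using L by (simp add: width_def)
  have "(\<Sum>j<N. \<omega> (Wt L 0 j) * tang x v \<omega> L j)
      = (\<Sum>j<N. \<Sum>k<d. v k * (\<omega> (Wt L 0 j) * tang x (\<lambda>i. if i = k then 1 else 0) \<omega> L j))"
    by (intro sum.cong refl) (subst tang_sum, auto simp: w sum_distrib_left mult_ac)
  also have "\<dots> = (\<Sum>k<d. v k * grad x \<omega> k)"
    unfolding grad_def sum_distrib_left by (rule sum.swap)
  also have "\<dots> = G" by (simp add: v_def G_def power2_eq_square)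
  finally have slope: "(\<Sum>j<N. \<omega> (Wt L 0 j) * tang x v \<omega> L j) = G" .
  have "\<forall>\<^sub>F h::real in at_right 0. h > 0" by (simp add: eventually_at_filter)
  then have "\<forall>\<^sub>F h in at_right 0. h > 0 \<and> (\<forall>i<N. act (\<lambda>k. x k + h * v k) \<omega> L i = act x \<omega> L i + h * tang x v \<omega> L i)"
    using eventually_act_affine[OF reg order_refl, of v] unfolding w by eventually_elim simp
  from eventually_happens'[OF trivial_limit_at_right_real this]
  obtain h where h: "h > 0"
    "\<And>i. i < N \<Longrightarrow> act (\<lambda>k. x k + h * v k) \<omega> L i = act x \<omega> L i + h * tang x v \<omega> L i"
    by blast
  let ?y = "\<lambda>k. x k + h * v k"
  have net: "net \<omega> d N L ?y - net \<omega> d N L x = h * G"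
    unfolding net_eq_act[OF L] using h(2)
    unfolding slope[symmetric] by (simp add: distrib_left sum.distrib sum_distrib_left mult_ac)
  have dist: "euclid_dist d ?y x = h * sqrt G"
  proof -
    have "(\<Sum>k<d. (?y k - x k)\<^sup>2) = h\<^sup>2 * G"
      by (simp add: v_def G_def sum_distrib_left power_mult_distrib)
    then show ?thesis using h(1) by (simp add: euclid_dist_def real_sqrt_mult)
  qed
  have "?y \<in> Rd d" using x by (simp add: Rd_def v_def)
  moreover have "?y \<noteq> x" using net G h(1) by auto
  ultimately have "ennreal (\<bar>net \<omega> d N L ?y - net \<omega> d N L x\<bar> / euclid_dist d ?y x) \<le> Lip d (net \<omega> d N L)"
    unfolding Lip_def using x by (intro SUP_upper2[of "(?y, x)"]) auto
  moreover have "\<bar>h * G\<bar> / (h * sqrt G) = sqrt G"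
    using h(1) G by (simp add: real_div_sqrt)
  ultimately show ?thesis unfolding net dist by (simp add: G_def)
qed simp

lemma AE_regular:
  assumes L: "L \<ge> 1" and x: "\<exists>j<d. x j \<noteq> 0"
  shows "AE \<omega> in PiM (param_set d N L) P. regular x \<omega>"
proof -
  have fin: "finite (param_set d N L)" by (simp add: param_set_eq[OF L])
  \<comment> \<open>The index bounds sit inside the implication, so that the null sets can be united
    over all triples of natural numbers. The activation at \<open>l\<close> depends on earlier
    layers only, so the weight \<open>Wt l i j\<close> is independent of it.\<close>
  have "AE \<omega> in PiM (param_set d N L) P. l < L \<and> i < N \<and> j < width l \<longrightarrow>
      act x \<omega> l j \<noteq> 0 \<longrightarrow> pre \<omega> l (act x \<omega> l) i \<noteq> 0" for l i j
  proof (cases "l < L \<and> i < N \<and> j < width l")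
    case True
    have "act x (fun_upd \<omega> (Wt l i j) v) l = act x \<omega> l" for \<omega> v
      by (intro act_cong) auto
    with True AE_pre_neq_0[of l j "param_set d N L" i "\<lambda>\<omega>. act x \<omega> l"] fin show ?thesis
      by (auto simp: param_set_eq[OF L])
  next
    case False
    then show ?thesis by (intro AE_I2) auto
  qed
  then have "AE \<omega> in PiM (param_set d N L) P. \<forall>l i j. l < L \<and> i < N \<and> j < width l \<longrightarrow>
      act x \<omega> l j \<noteq> 0 \<longrightarrow> pre \<omega> l (act x \<omega> l) i \<noteq> 0"
    unfolding AE_all_countable by blast
  then show ?thesis
  proof eventually_elim
    case (elim \<omega>)
    have "\<forall>j<width l. \<forall>v. tang x v \<omega> l j = 0"
      if "l < L" "i < N" "pre \<omega> l (act x \<omega> l) i = 0" for l i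
    proof -
      have *: "act x \<omega> l j = 0" if "j < width l" for j
        using elim that \<open>l < L\<close> \<open>i < N\<close> \<open>pre \<omega> l (act x \<omega> l) i = 0\<close> by blast
      show ?thesis
      proof (cases l)
        case 0
        then show ?thesis using * x by (auto simp: width_def)
      next
        case (Suc k)
        then show ?thesis using * tang_eq_0[of x \<omega> k] unfolding Suc width_def by auto
      qed
    qed
    then show ?case unfolding regular_def by blast
  qed
qed

text \<open>Integrating the output weights first, duality replaces the gradient by the tangent in a
  random Gaussian direction \<open>z\<close>. After exchanging the integrals \<open>z\<close> is
  fixed while the layers are integrated, so the tangent bound applies with \<open>s = 1\<close>; the
  Gaussian integral over \<open>z\<close> comes last.\<close>

lemma nn_integral_exp_grad_le:
  fixes Y :: real
  assumes L: "L \<ge> 1" and Y: "Y \<ge> 0" "3 * Y \<le> N" and x: "\<exists>j<d. x j \<noteq> 0"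
  defines "\<theta> \<equiv> 1 - 3 * Y / N"
  shows "(\<integral>\<^sup>+\<omega>. ennreal (exp (- (\<Sum>k<d. (grad x \<omega> k)\<^sup>2))) \<partial>PiM (param_set d N L) P)
       \<le> ennreal ((1 / sqrt (1 + 2 * \<theta> ^ L)) ^ d + real L * exp (- (\<theta> * Y)))"
proof -
  let ?T = "\<lambda>\<omega> j k. tang x (\<lambda>i. if i = k then 1 else 0) \<omega> L j"
  let ?G = "PiM {..<d} (\<lambda>_. gauss 1)"
  define W where "W = Wt L 0 ` {..<N}"
  define out where "out = insert (Bs L 0) W"
  interpret product_prob_space P "param_set d N L" by (rule product_prob_spaceI) simp
  interpret H: prob_space "PiM (layers L) P" by (rule prob_space_PiM_P)
  interpret G: prob_space ?G by (rule prob_space_PiM_gauss) simp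
  interpret HG: pair_prob_space "PiM (layers L) P" ?G ..
  have \<theta>: "\<theta> \<ge> 0" using Y N_pos by (simp add: \<theta>_def)
  have [simp]: "width L = N" using L by (simp add: width_def)
  have disj: "layers L \<inter> out = {}" by (auto simp: out_def W_def)
  have fin_out: "finite out" by (simp add: out_def W_def)
  define F where "F \<omega> = ennreal (exp (- (\<Sum>k<d. (grad x \<omega> k)\<^sup>2)))" for \<omega>
  have F [measurable]: "F \<in> borel_measurable (PiM (layers L \<union> out) P)"
    unfolding F_def by measurable
  have fold: "integral\<^sup>N (PiM (param_set d N L) P) F
      = (\<integral>\<^sup>+\<omega>. (\<integral>\<^sup>+\<omega>'. F (merge (layers L) out (\<omega>, \<omega>')) \<partial>PiM out P) \<partial>PiM (layers L) P)"
    unfolding param_set_eq[OF L] W_def[symmetric] out_def[symmetric]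
    by (intro product_nn_integral_fold disj F fin_out) simp
  have inner: "(\<integral>\<^sup>+\<omega>'. F (merge (layers L) out (\<omega>, \<omega>')) \<partial>PiM out P)
      = (\<integral>\<^sup>+z. ennreal (exp (- (\<Sum>j<N. (tang x z \<omega> L j)\<^sup>2))) \<partial>?G)" for \<omega>
  proof -
    \<comment> \<open>The Jacobian of the last hidden layer, with rows indexed by output weights;
      the value at bias parameters is a dummy outside \<open>W\<close>.\<close>
    define M where "M p k = (case p of Wt l i j \<Rightarrow> ?T \<omega> j k | Bs l i \<Rightarrow> 0)" for p k
    have "F (merge (layers L) out (\<omega>, \<omega>'))
        = ennreal (exp (- (1 * (\<Sum>k<d. (\<Sum>p\<in>W. restrict \<omega>' W p * M p k)\<^sup>2))))" for \<omega>'
    proof -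
      let ?m = "merge (layers L) out (\<omega>, \<omega>')"
      have "tang x z ?m L = tang x z \<omega> L" for z by (rule tang_cong) (auto simp: merge_def)
      moreover have "?m (Wt L 0 j) = \<omega>' (Wt L 0 j)" if "j < N" for j
        using that by (simp add: merge_def out_def W_def)
      ultimately have "grad x ?m k = (\<Sum>p\<in>W. \<omega>' p * M p k)" for k
        unfolding grad_def by (simp add: W_def sum_Wt_row M_def)
      then show ?thesis unfolding F_def by simp
    qed
    then have "(\<integral>\<^sup>+\<omega>'. F (merge (layers L) out (\<omega>, \<omega>')) \<partial>PiM out P)
        = (\<integral>\<^sup>+\<omega>'. ennreal (exp (- (1 * (\<Sum>k<d. (\<Sum>p\<in>W. \<omega>' p * M p k)\<^sup>2)))) \<partial>PiM W P)"
      using nn_integral_PiM_restrict[of P out W "\<lambda>\<omega>'. ennreal (exp (- (1 * (\<Sum>k<d. (\<Sum>p\<in>W. \<omega>' p * M p k)\<^sup>2))))"] fin_out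
      by (auto simp: out_def)
    also have "PiM W P = PiM W (\<lambda>_. gauss 1)"
      by (intro PiM_cong) (auto simp: W_def P_Wt)
    also have "(\<integral>\<^sup>+\<omega>'. ennreal (exp (- (1 * (\<Sum>k<d. (\<Sum>p\<in>W. \<omega>' p * M p k)\<^sup>2)))) \<partial>PiM W (\<lambda>_. gauss 1))
        = (\<integral>\<^sup>+z. ennreal (exp (- (\<Sum>p\<in>W. (\<Sum>k<d. M p k * z k)\<^sup>2))) \<partial>?G)"
      by (subst gauss_duality) (simp_all add: W_def)
    also have "\<dots> = (\<integral>\<^sup>+z. ennreal (exp (- (\<Sum>j<N. (tang x z \<omega> L j)\<^sup>2))) \<partial>?G)"
      by (simp add: W_def sum_Wt_row M_def tang_sum[of _ L x _ \<omega>] mult.commute)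
    finally show ?thesis .
  qed
  have z [measurable]: "(\<lambda>z. z k) \<in> borel_measurable ?G" for k
    by (rule measurable_PiM_real_component) simp
  have [measurable]: "(\<lambda>(\<omega>, z). tang x z \<omega> L j) \<in> borel_measurable (PiM (layers L) P \<Otimes>\<^sub>M ?G)" for j
    unfolding split_def by (rule measurable_tang[of _ _ "layers L"]) measurable
  have "integral\<^sup>N (PiM (param_set d N L) P) F
      = (\<integral>\<^sup>+z. (\<integral>\<^sup>+\<omega>. ennreal (exp (- (1 * (\<Sum>j<width L. (tang x z \<omega> L j)\<^sup>2)))) \<partial>PiM (layers L) P) \<partial>?G)"
    unfolding fold inner
    \<comment> \<open>Tonelli moves the integral over directions to the outside.\<close>
    by (subst HG.Fubini'[symmetric]) (simp_all add: split_def[symmetric])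
  also have "\<dots> \<le> (\<integral>\<^sup>+z. ennreal (exp (- (1 * \<theta> ^ L * (\<Sum>k<d. (z k)\<^sup>2))) + real L * exp (- (\<theta> * Y))) \<partial>?G)"
    unfolding \<theta>_def by (intro nn_integral_mono nn_integral_tang_le order_refl Y x) simp
  also have "\<dots> = (\<integral>\<^sup>+z. ennreal (exp (- (\<theta> ^ L * (\<Sum>k<d. (z k)\<^sup>2)))) \<partial>?G) + ennreal (real L * exp (- (\<theta> * Y)))"
    by (simp add: nn_integral_add G.emeasure_space_1)
  also have "\<dots> = ennreal ((1 / sqrt (1 + 2 * \<theta> ^ L)) ^ d + real L * exp (- (\<theta> * Y)))"
    using \<theta> by (simp add: nn_integral_PiM_gauss_exp_square)
  finally show ?thesis unfolding F_def .
qed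

section \<open>Lower tail of the Lipschitz constant\<close>

lemma prob_Lip_ge:
  assumes d: "d \<ge> 1" and L: "L \<ge> 1" and NL: "real N \<ge> 24 * real d * (real L)\<^sup>2"
  shows "measure (PiM (param_set d N L) P)
      {\<omega> \<in> space (PiM (param_set d N L) P). ennreal (sqrt (real d) / 4) \<le> Lip d (net \<omega> d N L)}
    \<ge> 1 - 2 * exp (- (real d / 4))"
proof -
  let ?\<mu> = "PiM (param_set d N L) P"
  interpret prob_space ?\<mu> by (rule prob_space_PiM_P)
  \<comment> \<open>The first unit vector serves as the fixed nonzero base point. At the origin zero
    biases would put every first-layer neuron at the kink.\<close>
  define x :: "nat \<Rightarrow> real" where "x i = (if i = 0 then 1 else 0)" for i
  \<comment> \<open>Large enough that the \<open>L\<close> error terms are negligible against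
    \<open>exp (- d / 4)\<close>, small enough that the width assumption gives
    \<open>3 * Y / N \<le> 1 / (2 * L)\<close>.\<close>
  define Y where "Y = 4 * real d * real L"
  define \<theta> where "\<theta> = 1 - 3 * Y / N"
  have x: "\<exists>j<d. x j \<noteq> 0" "x \<in> Rd d"
    using d by (auto simp: x_def Rd_def intro!: exI[of _ 0])
  have \<theta>_ge: "\<theta> \<ge> 1 - 1 / (2 * real L)"
  proof -
    have "3 * Y / N \<le> 3 * Y / (24 * real d * (real L)\<^sup>2)"
      using NL d L N_pos by (intro divide_left_mono) (auto simp: Y_def)
    also have "\<dots> = 1 / (2 * real L)" using d L by (simp add: Y_def power2_eq_square)
    finally show ?thesis by (simp add: \<theta>_def)
  qed
  moreover have "1 / (2 * real L) \<le> 1 / 2" using L by (simp add: field_simps)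
  ultimately have \<theta>1: "\<theta> \<ge> 1 / 2" by linarith
  \<comment> \<open>Bernoulli's inequality: a loss of at most \<open>1 / (2 * L)\<close> per layer
    costs at most 1/2 in total.\<close>
  have "real L * (\<theta> - 1) \<ge> real L * (- (1 / (2 * real L)))"
    using \<theta>_ge by (intro mult_left_mono) auto
  moreover have "1 + real L * (\<theta> - 1) \<le> (1 + (\<theta> - 1)) ^ L"
    using \<theta>1 by (intro Bernoulli_inequality) auto
  ultimately have "\<theta> ^ L \<ge> 1 / 2" using L by auto
  with \<theta>1 have \<theta>: "\<theta> \<ge> 1 / 2" "\<theta> ^ L \<ge> 1 / 2" by auto
  have Y: "Y \<ge> 0" "3 * Y \<le> N"
  proof -
    show "Y \<ge> 0" by (simp add: Y_def)
    have "3 * Y / N \<le> 1" using \<theta>(1) by (simp add: \<theta>_def)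
    then show "3 * Y \<le> N" using N_pos by (simp add: field_simps)
  qed
  define g where "g \<omega> = (\<Sum>k<d. (grad x \<omega> k)\<^sup>2)" for \<omega>
  have [measurable]: "g \<in> borel_measurable ?\<mu>" unfolding g_def by measurable
  have [measurable]: "(\<lambda>\<omega>. Lip d (net \<omega> d N L)) \<in> borel_measurable ?\<mu>"
    by (rule measurable_Lip_net[OF L])
  \<comment> \<open>Chernoff's method: the event \<open>g \<omega> \<le> d / 16\<close> is rewritten
    through the exponential and bounded by Markov's inequality.\<close>
  have "emeasure ?\<mu> {\<omega> \<in> space ?\<mu>. 1 \<le> ennreal (exp (real d / 16)) * ennreal (exp (- g \<omega>))}
      \<le> ennreal (exp (real d / 16)) * (\<integral>\<^sup>+\<omega>. ennreal (exp (- g \<omega>)) * indicator (space ?\<mu>) \<omega> \<partial>?\<mu>)"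
    by (rule nn_integral_Markov_inequality) auto
  also have "(\<integral>\<^sup>+\<omega>. ennreal (exp (- g \<omega>)) * indicator (space ?\<mu>) \<omega> \<partial>?\<mu>) = (\<integral>\<^sup>+\<omega>. ennreal (exp (- g \<omega>)) \<partial>?\<mu>)"
    by (intro nn_integral_cong) simp
  also have "ennreal (exp (real d / 16)) * \<dots>
      \<le> ennreal (exp (real d / 16)) * ennreal ((1 / sqrt (1 + 2 * \<theta> ^ L)) ^ d + real L * exp (- (\<theta> * Y)))"
    unfolding g_def \<theta>_def by (intro mult_left_mono nn_integral_exp_grad_le[OF L Y x(1)]) simp
  also have "\<dots> \<le> ennreal (2 * exp (- (real d / 4)))"
    using chernoff_exponents[OF \<theta> L d] \<theta>
    by (subst ennreal_mult[symmetric]) (auto simp: Y_def intro!: ennreal_leI add_nonneg_nonneg)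
  finally have "prob {\<omega> \<in> space ?\<mu>. 1 \<le> ennreal (exp (real d / 16)) * ennreal (exp (- g \<omega>))} \<le> 2 * exp (- (real d / 4))"
    by (simp add: emeasure_eq_measure)
  also have "{\<omega> \<in> space ?\<mu>. 1 \<le> ennreal (exp (real d / 16)) * ennreal (exp (- g \<omega>))} = {\<omega> \<in> space ?\<mu>. g \<omega> \<le> real d / 16}"
    by (auto simp: mult_exp_exp simp flip: ennreal_mult)
  finally have small: "prob {\<omega> \<in> space ?\<mu>. g \<omega> \<le> real d / 16} \<le> 2 * exp (- (real d / 4))" .
  have "1 - prob {\<omega> \<in> space ?\<mu>. g \<omega> \<le> real d / 16} = prob (space ?\<mu> - {\<omega> \<in> space ?\<mu>. g \<omega> \<le> real d / 16})"
    by (intro prob_compl[symmetric]) measurable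
  also have "\<dots> \<le> prob {\<omega> \<in> space ?\<mu>. ennreal (sqrt (real d) / 4) \<le> Lip d (net \<omega> d N L)}"
  proof (rule finite_measure_mono_AE)
    show "AE \<omega> in ?\<mu>. \<omega> \<in> space ?\<mu> - {\<omega> \<in> space ?\<mu>. g \<omega> \<le> real d / 16} \<longrightarrow>
        \<omega> \<in> {\<omega> \<in> space ?\<mu>. ennreal (sqrt (real d) / 4) \<le> Lip d (net \<omega> d N L)}"
      using AE_regular[OF L x(1)]
    proof eventually_elim
      case (elim \<omega>)
      have "ennreal (sqrt (real d) / 4) \<le> Lip d (net \<omega> d N L)" if "g \<omega> > real d / 16"
      proof -
        have "sqrt (real d) / 4 = sqrt (real d / 16)" by (simp add: real_sqrt_divide)
        also have "\<dots> \<le> sqrt (g \<omega>)" using that by simp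
        finally have "ennreal (sqrt (real d) / 4) \<le> ennreal (sqrt (g \<omega>))" by (rule ennreal_leI)
        also have "\<dots> \<le> Lip d (net \<omega> d N L)"
          unfolding g_def by (rule Lip_ge_grad[OF L elim x(2)])
        finally show ?thesis .
      qed
      then show ?case by auto
    qed
  qed measurable
  finally show ?thesis using small by linarith
qed

end

section \<open>Reduction to symmetric factors and the two claims\<close>

text \<open>Entries of \<open>D\<close> outside the parameter set are unconstrained; they are replaced by Gaussians so that
  every factor of the product is a symmetric probability measure.\<close>
lemma net_measure_eq_relu_net:
  assumes "N \<ge> 1" "L \<ge> 1" "\<And>l i. l < L \<Longrightarrow> i < N \<Longrightarrow> symmetric_dist (D l i)" "symmetric_dist (D L 0)"
  obtains D' where "relu_net N D'" "net_measure d N L D = PiM (param_set d N L) (param_dist N L D')"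
proof
  define D' where "D' l i = (if l < L \<and> i < N \<or> l = L \<and> i = 0 then D l i else gauss 1)" for l i
  show "relu_net N D'"
    using assms by unfold_locales (auto simp: D'_def symmetric_dist_gauss)
  show "net_measure d N L D = PiM (param_set d N L) (param_dist N L D')"
    unfolding net_measure_def
    by (intro PiM_cong) (auto simp: param_set_def param_dist_def D'_def)
qed

theorem theorem3p4:
  shows "\<exists>C c\<^sub>1 c\<^sub>2 :: real. C > 0 \<and> c\<^sub>1 > 0 \<and> c\<^sub>2 > 0 \<and>
    (\<forall>(d::nat) (N::nat) (L::nat) (D :: nat \<Rightarrow> nat \<Rightarrow> real measure).
       d \<ge> 1 \<longrightarrow> L \<ge> 1 \<longrightarrow> real N \<ge> C * real d * (real L)\<^sup>2 \<longrightarrow>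
       (\<forall>l<L. \<forall>i<N. symmetric_dist (D l i)) \<longrightarrow> symmetric_dist (D L 0) \<longrightarrow>
       measure (net_measure d N L D)
          {\<omega> \<in> space (net_measure d N L D). Lip d (net \<omega> d N L) \<ge> ennreal (sqrt (real d) / 4)}
         \<ge> (1 - 2 powr (- real N) - exp (- real N / (C * (real L)\<^sup>2))) ^ L
            * max 0 (1 - 2 * exp (- c\<^sub>1 * real d))
       \<and> (real N \<ge> C * (real L)\<^sup>2 * ln (4 * real L) \<longrightarrow> real d > ln 2 / c\<^sub>1 \<longrightarrow>
           (\<integral>\<^sup>+ \<omega>. Lip d (net \<omega> d N L) \<partial>net_measure d N L D) \<ge> ennreal (c\<^sub>2 * sqrt (real d))))"
proof -
  \<comment> \<open>The second claim assumes \<open>d > 4 * ln 2\<close>, hence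
    \<open>d \<ge> 3\<close>, so the event has probability at least
    \<open>1 - 2 * exp (- (3 / 4)) = 4 * c\<close>; the threshold \<open>sqrt d / 4\<close> supplies
    the factor 1/4.\<close>
  define c :: real where "c = (1 - 2 * exp (- (3 / 4))) / 4"
  have "(2::real) < exp (3 / 4)"
    using exp_lower_Taylor_quadratic[of "3 / 4"] by (simp add: power2_eq_square)
  then have c: "c > 0" by (simp add: c_def exp_minus field_simps)
  show ?thesis
  proof (rule exI[of _ 24], rule exI[of _ "1 / 4"], rule exI[of _ c], intro conjI allI impI c)
    fix d N L :: nat and D :: "nat \<Rightarrow> nat \<Rightarrow> real measure"
    assume d: "d \<ge> 1" and L: "L \<ge> 1" and N: "real N \<ge> 24 * real d * (real L)\<^sup>2"
      and D: "\<forall>l<L. \<forall>i<N. symmetric_dist (D l i)" "symmetric_dist (D L 0)"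
    have "0 < 24 * real d * (real L)\<^sup>2" using d L by simp
    with N have N1: "N \<ge> 1" by linarith
    obtain D' where D': "relu_net N D'"
      and eq: "net_measure d N L D = PiM (param_set d N L) (param_dist N L D')"
      using net_measure_eq_relu_net[OF N1 L, of D d] D by blast
    interpret relu_net d N L D' by (rule D')
    let ?\<mu> = "net_measure d N L D"
    let ?E = "{\<omega> \<in> space ?\<mu>. ennreal (sqrt (real d) / 4) \<le> Lip d (net \<omega> d N L)}"
    interpret prob_space ?\<mu> unfolding eq by (rule prob_space_PiM_P)
    have E: "prob ?E \<ge> 1 - 2 * exp (- (real d / 4))"
      unfolding eq by (rule prob_Lip_ge[OF d L N])
    show "(1 - 2 powr (- real N) - exp (- real N / (24 * (real L)\<^sup>2))) ^ L
        * max 0 (1 - 2 * exp (- (1 / 4) * real d)) \<le> prob ?E"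
    proof -
      \<comment> \<open>The base may be negative, but both subtracted terms lie between 0 and 1, so
        its absolute value and hence its \<open>L\<close>-th power are at most 1.\<close>
      define b where "b = 1 - 2 powr (- real N) - exp (- real N / (24 * (real L)\<^sup>2))"
      have "2 powr (- real N) \<le> 1" by (simp add: powr_minus_divide ge_one_powr_ge_zero)
      moreover have "exp (- real N / (24 * (real L)\<^sup>2)) \<le> 1" by simp
      moreover have "2 powr (- real N) > 0" "exp (- real N / (24 * (real L)\<^sup>2)) > 0" by simp_all
      ultimately have "\<bar>b\<bar> \<le> 1" unfolding b_def by linarith
      then have "\<bar>b\<bar> ^ L \<le> 1" by (intro power_le_one) auto
      then have "b ^ L \<le> 1" using abs_le_D1[of "b ^ L" 1] by (simp add: power_abs)
      then have "b ^ L * max 0 (1 - 2 * exp (- (1 / 4) * real d)) \<le> 1 * max 0 (1 - 2 * exp (- (1 / 4) * real d))"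
        by (intro mult_right_mono) auto
      also have "\<dots> \<le> prob ?E" using E by simp
      finally show ?thesis by (simp add: b_def)
    qed
    assume "ln 2 / (1 / 4) < real d"
    then have "4 * ln 2 < real d" by simp
    then have "real d > 2" using ln2_ge_two_thirds by linarith
    then have "real d \<ge> 3" by simp
    then have "4 * c \<le> 1 - 2 * exp (- (real d / 4))" by (simp add: c_def)
    also note E
    finally have "4 * c \<le> prob ?E" .
    have [measurable]: "(\<lambda>\<omega>. Lip d (net \<omega> d N L)) \<in> borel_measurable ?\<mu>"
      unfolding eq by (rule measurable_Lip_net[OF L])
    \<comment> \<open>The expectation is at least the threshold times the probability of exceeding
      it.\<close>
    have "c * sqrt (real d) = sqrt (real d) / 4 * (4 * c)" by simp
    also have "\<dots> \<le> sqrt (real d) / 4 * prob ?E"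
      using \<open>4 * c \<le> prob ?E\<close> by (intro mult_left_mono) auto
    finally have "ennreal (c * sqrt (real d)) \<le> ennreal (sqrt (real d) / 4) * emeasure ?\<mu> ?E"
      by (simp add: emeasure_eq_measure ennreal_leI flip: ennreal_mult)
    also have "\<dots> = (\<integral>\<^sup>+\<omega>. ennreal (sqrt (real d) / 4) * indicator ?E \<omega> \<partial>?\<mu>)"
      by (subst nn_integral_cmult_indicator) measurable
    also have "\<dots> \<le> (\<integral>\<^sup>+\<omega>. Lip d (net \<omega> d N L) \<partial>?\<mu>)"
      by (intro nn_integral_mono) (auto simp: indicator_def)
    finally show "ennreal (c * sqrt (real d)) \<le> (\<integral>\<^sup>+\<omega>. Lip d (net \<omega> d N L) \<partial>?\<mu>)" .
  qed auto
qed

end
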